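(* Let $Y$ be a complex Banach space and $X\subset Y$ a closed subspace. Suppose that $X$ is symmetrically regular and that there is an isometric extension morphism $s:X^*\to Y^*$. Then $\mathcal G_0(B_X)\subset\mathcal G_0(B_Y)$; that is, the map $\rho:\mathcal G_0(B_X)\to\mathcal G_0(B_Y)$, $\rho(\varphi)(f)=\varphi(f|_{B_X})$ for $f\in\mathcal HL_0(B_Y)$, is a linear isometry onto its image.
   Context: $X$ is symmetrically regular if every bounded symmetric linear operator $T:X\to X^*$ (i.e. $T(x)(y)=T(y)(x)$ for all $x,y\in X$) is weakly compact. An isometric extension morphism $s:X^*\to Y^*$ is a linear map with $s(x^* )(x)=x^*(x)$ for all $x\in X$, $x^*\in X^*$, and $\|s(x^* )\|=\|x^*\|$ for all $x^*\in X^*$. $B_X$ is the open unit ball of $X$. $\mathcal HL_0(B_X)$ is the Banach space of holomorphic Lipschitz functions $f:B_X\to\mathbb C$ with $f(0)=0$, normed by the Lipschitz constant $L(f)$. With $\tau_0$ the compact-open topology (uniform convergence on compact subsets of $B_X$), $\mathcal G_0(B_X)=\{\varphi\in\mathcal HL_0(B_X)^*: \varphi \text{ restricted to } \{f:L(f)\le1\}\text{ is }\tau_0\text{-continuous}\}$, with the norm of $\mathcal HL_0(B_X)^*$; similarly for $Y$. *)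

theory Defs
  imports "HOL-Analysis.Analysis" "HOL-Library.Function_Algebras"
begin

section \<open>Complex vector spaces and complex Banach spaces\<close>

class scaleC =
  fixes scaleC :: "complex \<Rightarrow> 'a \<Rightarrow> 'a"  (infixr "*\<^sub>C" 75)

class complex_vector = ab_group_add + scaleC +
  assumes scaleC_add_right: "a *\<^sub>C (x + y) = a *\<^sub>C x + a *\<^sub>C y"
    and scaleC_add_left: "(a + b) *\<^sub>C x = a *\<^sub>C x + b *\<^sub>C x"
    and scaleC_scaleC: "a *\<^sub>C b *\<^sub>C x = (a * b) *\<^sub>C x"
    and scaleC_one: "1 *\<^sub>C x = x"

class complex_normed_vector = complex_vector + real_normed_vector +
  assumes scaleR_scaleC: "scaleR r x = complex_of_real r *\<^sub>C x"
    and norm_scaleC: "norm (a *\<^sub>C x) = cmod a * norm x"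

class complex_banach = complex_normed_vector + complete_space

instantiation complex :: complex_banach
begin
definition scaleC_complex :: "complex \<Rightarrow> complex \<Rightarrow> complex" where
  "scaleC_complex a x = a * x"
instance
  by standard (auto simp: scaleC_complex_def algebra_simps norm_mult scaleR_conv_of_real)
end

instantiation "fun" :: (type, complex_vector) complex_vector
begin
definition scaleC_fun :: "complex \<Rightarrow> ('a \<Rightarrow> 'b) \<Rightarrow> 'a \<Rightarrow> 'b" where
  "scaleC_fun a f = (\<lambda>x. a *\<^sub>C f x)"
instance
  by standard (auto simp: scaleC_fun_def plus_fun_def scaleC_add_right scaleC_add_left
      scaleC_scaleC scaleC_one)
end

definition csubspace :: "'a::complex_vector set \<Rightarrow> bool" where
  "csubspace V \<longleftrightarrow> 0 \<in> V \<and> (\<forall>x\<in>V. \<forall>y\<in>V. x + y \<in> V) \<and> (\<forall>c. \<forall>x\<in>V. c *\<^sub>C x \<in> V)"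

section \<open>Normed spaces on a carrier\<close>

text \<open>
  A normed space is given by a carrier \<open>V\<close> and a function \<open>N\<close> whose restriction to \<open>V\<close> is the
  norm. Functions that live on a carrier (functionals, holomorphic functions on a ball) are
  represented by total functions that vanish off it; this representation is unique and compatible
  with the pointwise vector space structure.
\<close>

definition zero_off :: "'a set \<Rightarrow> ('a \<Rightarrow> 'b::zero) \<Rightarrow> bool" where
  "zero_off A f \<longleftrightarrow> (\<forall>x. x \<notin> A \<longrightarrow> f x = 0)"

definition restr :: "'a set \<Rightarrow> ('a \<Rightarrow> 'b::zero) \<Rightarrow> 'a \<Rightarrow> 'b" where
  "restr A f = (\<lambda>x. if x \<in> A then f x else 0)"

definition clinear_on :: "'a::complex_vector set \<Rightarrow> ('a \<Rightarrow> 'b::complex_vector) \<Rightarrow> bool" where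
  "clinear_on V T \<longleftrightarrow>
     (\<forall>x\<in>V. \<forall>y\<in>V. T (x + y) = T x + T y) \<and> (\<forall>c. \<forall>x\<in>V. T (c *\<^sub>C x) = c *\<^sub>C T x)"

definition bounded_clinear_on ::
  "'a::complex_vector set \<Rightarrow> ('a \<Rightarrow> real) \<Rightarrow> 'b::complex_vector set \<Rightarrow> ('b \<Rightarrow> real) \<Rightarrow> ('a \<Rightarrow> 'b) \<Rightarrow> bool"
  where
  "bounded_clinear_on V NV W NW T \<longleftrightarrow>
     T ` V \<subseteq> W \<and> clinear_on V T \<and> (\<exists>K. \<forall>x\<in>V. NW (T x) \<le> K * NV x)"

definition linear_isometry_on ::
  "'a::complex_vector set \<Rightarrow> ('a \<Rightarrow> real) \<Rightarrow> 'b::complex_vector set \<Rightarrow> ('b \<Rightarrow> real) \<Rightarrow> ('a \<Rightarrow> 'b) \<Rightarrow> bool"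
  where
  "linear_isometry_on V NV W NW T \<longleftrightarrow>
     T ` V \<subseteq> W \<and> clinear_on V T \<and> (\<forall>x\<in>V. NW (T x) = NV x)"

definition dual_space :: "'a::complex_vector set \<Rightarrow> ('a \<Rightarrow> real) \<Rightarrow> ('a \<Rightarrow> complex) set" where
  "dual_space V N = {\<phi>. bounded_clinear_on V N UNIV cmod \<phi> \<and> zero_off V \<phi>}"

definition dual_norm :: "'a set \<Rightarrow> ('a \<Rightarrow> real) \<Rightarrow> ('a \<Rightarrow> complex) \<Rightarrow> real" where
  "dual_norm V N \<phi> = (SUP v\<in>{v\<in>V. N v \<le> 1}. cmod (\<phi> v))"

definition weak_topology :: "'a::complex_vector set \<Rightarrow> ('a \<Rightarrow> real) \<Rightarrow> 'a topology" where
  "weak_topology V N =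
     topology_generated_by {{v\<in>V. \<phi> v \<in> U} |\<phi> U. \<phi> \<in> dual_space V N \<and> open U}"

definition weakly_compact_operator ::
  "'a set \<Rightarrow> ('a \<Rightarrow> real) \<Rightarrow> 'b::complex_vector set \<Rightarrow> ('b \<Rightarrow> real) \<Rightarrow> ('a \<Rightarrow> 'b) \<Rightarrow> bool" where
  "weakly_compact_operator V NV W NW T \<longleftrightarrow>
     compactin (weak_topology W NW)
       (weak_topology W NW closure_of (T ` {v\<in>V. NV v \<le> 1}))"

section \<open>Symmetric regularity and extension morphisms\<close>

abbreviation dual :: "'a::complex_normed_vector set \<Rightarrow> ('a \<Rightarrow> complex) set" where
  "dual X \<equiv> dual_space X norm"

definition symmetrically_regular :: "'a::complex_normed_vector set \<Rightarrow> bool" where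
  "symmetrically_regular X \<longleftrightarrow>
     (\<forall>T. bounded_clinear_on X norm (dual X) (dual_norm X norm) T \<and>
          (\<forall>x\<in>X. \<forall>y\<in>X. T x y = T y x) \<longrightarrow>
        weakly_compact_operator X norm (dual X) (dual_norm X norm) T)"

definition isometric_extension_morphism ::
  "'a::complex_normed_vector set \<Rightarrow> 'a set \<Rightarrow> (('a \<Rightarrow> complex) \<Rightarrow> 'a \<Rightarrow> complex) \<Rightarrow> bool" where
  "isometric_extension_morphism X Y s \<longleftrightarrow>
     linear_isometry_on (dual X) (dual_norm X norm) (dual Y) (dual_norm Y norm) s \<and>
     (\<forall>\<phi>\<in>dual X. \<forall>x\<in>X. s \<phi> x = \<phi> x)"

section \<open>Holomorphic Lipschitz functions\<close>

definition unit_ball :: "'a::real_normed_vector set \<Rightarrow> 'a set" where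
  "unit_ball X = {x\<in>X. norm x < 1}"

text \<open>Complex Frechet differentiability at each point, with increments taken in \<open>X\<close> only.\<close>

definition holomorphic_on_ball ::
  "'a::complex_normed_vector set \<Rightarrow> ('a \<Rightarrow> complex) \<Rightarrow> bool" where
  "holomorphic_on_ball X f \<longleftrightarrow>
     (\<forall>x\<in>unit_ball X. \<exists>D\<in>dual X.
        ((\<lambda>h. cmod (f (x + h) - f x - D h) / norm h) \<longlongrightarrow> 0) (at 0 within X))"

text \<open>The pairs with \<open>x = y\<close> contribute \<open>0 / 0 = 0\<close>, so the supremum is never over the empty set.\<close>

definition lip_const :: "'a::real_normed_vector set \<Rightarrow> ('a \<Rightarrow> complex) \<Rightarrow> real" where
  "lip_const X f = (SUP (x, y)\<in>unit_ball X \<times> unit_ball X. cmod (f x - f y) / norm (x - y))"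

definition HL0 :: "'a::complex_normed_vector set \<Rightarrow> ('a \<Rightarrow> complex) set" where
  "HL0 X = {f. holomorphic_on_ball X f \<and> (\<exists>C. C-lipschitz_on (unit_ball X) f) \<and>
               f 0 = 0 \<and> zero_off (unit_ball X) f}"

definition HL0_ball :: "'a::complex_normed_vector set \<Rightarrow> ('a \<Rightarrow> complex) set" where
  "HL0_ball X = {f \<in> HL0 X. lip_const X f \<le> 1}"

definition tau0_nhd ::
  "'a::complex_normed_vector set \<Rightarrow> ('a \<Rightarrow> complex) \<Rightarrow> 'a set \<Rightarrow> real \<Rightarrow> ('a \<Rightarrow> complex) set" where
  "tau0_nhd X f K e = {g \<in> HL0 X. \<forall>x\<in>K. cmod (g x - f x) < e}"

definition tau0_open :: "'a::complex_normed_vector set \<Rightarrow> ('a \<Rightarrow> complex) set \<Rightarrow> bool" where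
  "tau0_open X U \<longleftrightarrow> U \<subseteq> HL0 X \<and>
     (\<forall>f\<in>U. \<exists>K e. compact K \<and> K \<subseteq> unit_ball X \<and> e > 0 \<and> tau0_nhd X f K e \<subseteq> U)"

definition tau0 :: "'a::complex_normed_vector set \<Rightarrow> ('a \<Rightarrow> complex) topology" where
  "tau0 X = topology (tau0_open X)"

lemma istopology_tau0_open: "istopology (tau0_open X)"
  unfolding istopology_def
proof (intro conjI allI impI)
  fix S T assume S: "tau0_open X S" and T: "tau0_open X T"
  show "tau0_open X (S \<inter> T)"
    unfolding tau0_open_def
  proof (intro conjI ballI)
    show "S \<inter> T \<subseteq> HL0 X" using S by (auto simp: tau0_open_def)
    fix f assume f: "f \<in> S \<inter> T"
    obtain K e where K: "compact K" "K \<subseteq> unit_ball X" "e > 0" "tau0_nhd X f K e \<subseteq> S"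
      using S f unfolding tau0_open_def by (metis IntD1)
    obtain K' e' where K': "compact K'" "K' \<subseteq> unit_ball X" "e' > 0" "tau0_nhd X f K' e' \<subseteq> T"
      using T f unfolding tau0_open_def by (metis IntD2)
    have "tau0_nhd X f (K \<union> K') (min e e') \<subseteq> tau0_nhd X f K e \<inter> tau0_nhd X f K' e'"
      by (auto simp: tau0_nhd_def)
    then have "tau0_nhd X f (K \<union> K') (min e e') \<subseteq> S \<inter> T"
      using K(4) K'(4) by blast
    moreover have "compact (K \<union> K')" "K \<union> K' \<subseteq> unit_ball X" "min e e' > 0"
      using K K' by (auto intro: compact_Un)
    ultimately show "\<exists>K e. compact K \<and> K \<subseteq> unit_ball X \<and> e > 0 \<and> tau0_nhd X f K e \<subseteq> S \<inter> T"
      by blast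
  qed
next
  fix \<U> assume U: "\<forall>S\<in>\<U>. tau0_open X S"
  show "tau0_open X (\<Union>\<U>)"
    unfolding tau0_open_def
  proof (intro conjI ballI)
    show "\<Union>\<U> \<subseteq> HL0 X" using U by (auto simp: tau0_open_def)
    fix f assume "f \<in> \<Union>\<U>"
    then obtain S where S: "S \<in> \<U>" "f \<in> S" by blast
    then obtain K e where "compact K" "K \<subseteq> unit_ball X" "e > 0" "tau0_nhd X f K e \<subseteq> S"
      using U unfolding tau0_open_def by metis
    with S(1) show "\<exists>K e. compact K \<and> K \<subseteq> unit_ball X \<and> e > 0 \<and> tau0_nhd X f K e \<subseteq> \<Union>\<U>"
      by blast
  qed
qed

lemma openin_tau0: "openin (tau0 X) U \<longleftrightarrow> tau0_open X U"
  by (simp add: tau0_def istopology_tau0_open topology_inverse')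

section \<open>The predual\<close>

definition HL0_dual :: "'a::complex_normed_vector set \<Rightarrow> (('a \<Rightarrow> complex) \<Rightarrow> complex) set" where
  "HL0_dual X = dual_space (HL0 X) (lip_const X)"

definition G0 :: "'a::complex_normed_vector set \<Rightarrow> (('a \<Rightarrow> complex) \<Rightarrow> complex) set" where
  "G0 X = {\<phi> \<in> HL0_dual X. continuous_map (subtopology (tau0 X) (HL0_ball X)) euclidean \<phi>}"

definition G0_norm :: "'a::complex_normed_vector set \<Rightarrow> (('a \<Rightarrow> complex) \<Rightarrow> complex) \<Rightarrow> real" where
  "G0_norm X = dual_norm (HL0 X) (lip_const X)"

definition rho :: "'a::complex_normed_vector set \<Rightarrow> 'a set \<Rightarrow>
    (('a \<Rightarrow> complex) \<Rightarrow> complex) \<Rightarrow> ('a \<Rightarrow> complex) \<Rightarrow> complex" where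
  "rho X Y \<phi> = restr (HL0 Y) (\<lambda>f. \<phi> (restr (unit_ball X) f))"

text \<open>The functional \<open>\<phi>\<close> vanishes off \<open>HL0 X\<close>; by the next lemma \<open>rho\<close> never uses those values.\<close>

lemma restr_unit_ball_HL0:
  assumes X: "csubspace X" and XY: "X \<subseteq> Y" and f: "f \<in> HL0 Y"
  shows "restr (unit_ball X) f \<in> HL0 X"
proof -
  have sub: "unit_ball X \<subseteq> unit_ball Y" using XY by (auto simp: unit_ball_def)
  have zero: "0 \<in> unit_ball X" using X by (auto simp: csubspace_def unit_ball_def)
  obtain C where C: "C-lipschitz_on (unit_ball Y) f" using f by (auto simp: HL0_def)
  have lip: "C-lipschitz_on (unit_ball X) (restr (unit_ball X) f)"
    using C sub unfolding lipschitz_on_def restr_def by auto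
  have "holomorphic_on_ball X (restr (unit_ball X) f)"
    unfolding holomorphic_on_ball_def
  proof
    fix x assume x: "x \<in> unit_ball X"
    obtain D where D: "D \<in> dual Y"
      "((\<lambda>h. cmod (f (x + h) - f x - D h) / norm h) \<longlongrightarrow> 0) (at 0 within Y)"
      using f x sub unfolding HL0_def holomorphic_on_ball_def by blast
    have D': "restr X D \<in> dual X"
    proof -
      obtain K where "\<forall>x\<in>Y. cmod (D x) \<le> K * norm x"
        using D(1) by (auto simp: dual_space_def bounded_clinear_on_def)
      then have "\<forall>x\<in>X. cmod (restr X D x) \<le> K * norm x"
        using XY by (auto simp: restr_def)
      then show ?thesis
        using D(1) X XY
        unfolding dual_space_def bounded_clinear_on_def clinear_on_def zero_off_def csubspace_def
        by (auto simp: restr_def subset_iff)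
    qed
    have lim: "((\<lambda>h. cmod (f (x + h) - f x - D h) / norm h) \<longlongrightarrow> 0) (at 0 within X)"
      using D(2) XY by (rule tendsto_within_subset)
    have "eventually (\<lambda>h. norm h < 1 - norm x) (at 0 within X)"
      unfolding eventually_at by (rule exI[of _ "1 - norm x"]) (use x in \<open>auto simp: unit_ball_def\<close>)
    moreover have "eventually (\<lambda>h. h \<in> X) (at 0 within X)"
      by (auto simp: eventually_at_filter)
    ultimately have "eventually (\<lambda>h. cmod (f (x + h) - f x - D h) / norm h =
        cmod (restr (unit_ball X) f (x + h) - restr (unit_ball X) f x - restr X D h) / norm h)
        (at 0 within X)"
    proof eventually_elim
      case (elim h)
      have "norm (x + h) < 1" using norm_triangle_ineq[of x h] elim by linarith
      then have "x + h \<in> unit_ball X" using X x elim by (auto simp: csubspace_def unit_ball_def)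
      then show ?case using x elim by (simp add: restr_def)
    qed
    then have "((\<lambda>h. cmod (restr (unit_ball X) f (x + h) - restr (unit_ball X) f x - restr X D h)
        / norm h) \<longlongrightarrow> 0) (at 0 within X)"
      using lim tendsto_cong by fast
    with D' show "\<exists>D\<in>dual X. ((\<lambda>h. cmod (restr (unit_ball X) f (x + h) -
        restr (unit_ball X) f x - D h) / norm h) \<longlongrightarrow> 0) (at 0 within X)"
      by blast
  qed
  then show ?thesis
    using lip f zero by (auto simp: HL0_def restr_def zero_off_def)
qed

end

theory Submission
  imports Defs "HOL-Complex_Analysis.Cauchy_Integral_Formula"
begin

text \<open>
  Restriction to the ball of \<open>X\<close> is a contraction from \<open>HL0 Y\<close> to \<open>HL0 X\<close> that is continuous for
  the compact-open topologies, so its transpose \<open>rho\<close> maps \<open>G0 X\<close> linearly and contractively into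
  \<open>G0 Y\<close>. It is isometric because restriction maps the closed unit ball of \<open>HL0 Y\<close> onto that of
  \<open>HL0 X\<close>: every holomorphic \<open>f\<close> on the ball of \<open>X\<close> with Lipschitz constant at most \<open>1\<close> and
  \<open>f 0 = 0\<close> has a holomorphic extension \<open>F\<close> to the ball of \<open>Y\<close> with Lipschitz constant at most \<open>1\<close>
  (\<open>holomorphic_lipschitz_extension\<close>).

  If there were a linear contraction \<open>T\<close> from \<open>Y\<close> onto \<open>X\<close> that fixes \<open>X\<close>, then \<open>f \<circ> T\<close> would be
  such an extension. The morphism \<open>s\<close> only says that such contractions exist locally and
  approximately. Given finitely many expressions \<open>\<Sum> c y y + a\<close> with vectors \<open>y\<close> of \<open>Y\<close> and a
  vector \<open>a\<close> of \<open>X\<close>, some map \<open>T\<close> into \<open>X\<close> satisfies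
  \<open>norm (\<Sum> c y T y + a) < norm (\<Sum> c y y + a) + e\<close> for all of them (\<open>local_reflexivity\<close>);
  applied to vanishing combinations this says that \<open>T\<close> is almost linear, and with \<open>a = - x\<close> it says
  that \<open>T\<close> almost fixes \<open>x\<close>. The proof is a Hahn--Banach separation in a finite power of \<open>X\<close>: the
  functionals that would separate are carried to \<open>Y\<close> by \<open>s\<close>, with their linear relations and norms
  intact, and yield a contradiction there. Since finitely many constraints can always be met, there is
  a filter of maps \<open>T\<close> along which all of them hold eventually (\<open>almost_linear_filter_exists\<close>).

  Then \<open>F y = lim f (T y)\<close> along a finer filter. It extends \<open>f\<close> since \<open>T x\<close> tends to \<open>x\<close> for
  \<open>x \<in> X\<close>, and it is Lipschitz with the constant of \<open>f\<close> since \<open>norm (T y - T z)\<close> is eventually at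
  most \<open>norm (y - z) + e\<close>. It is holomorphic since the derivatives \<open>D (T y) (T h)\<close> of \<open>f\<close> converge to
  a bounded linear functional of \<open>h\<close>, and the error of the first order expansion of \<open>f\<close> is
  quadratic with a constant that is uniform on smaller balls (\<open>uniform_second_order_bound\<close>).
\<close>

section \<open>The Hahn--Banach theorem for complex seminorms\<close>

lemma scaleC_zero_right: "c *\<^sub>C 0 = (0::'a::complex_vector)"
  using scaleC_add_right[of c 0 "0::'a"] by simp

lemma scaleC_zero_left: "0 *\<^sub>C x = (0::'a::complex_vector)"
  using scaleC_add_left[of 0 0 x] by simp

lemma scaleC_minus_left: "(- c) *\<^sub>C x = - (c *\<^sub>C x)" for x :: "'a::complex_vector"
  using scaleC_add_left[of c "- c" x] by (simp add: scaleC_zero_left eq_neg_iff_add_eq_0 add.commute)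

lemma scaleC_minus_one: "(- 1) *\<^sub>C x = - x" for x :: "'a::complex_vector"
  by (simp add: scaleC_minus_left scaleC_one)

lemma scaleC_sum_right: "c *\<^sub>C sum f A = (\<Sum>i\<in>A. c *\<^sub>C f i)" for f :: "'i \<Rightarrow> 'a::complex_vector"
  by (induction A rule: infinite_finite_induct) (simp_all add: scaleC_zero_right scaleC_add_right)

lemma sum_fun_apply: "sum f A x = (\<Sum>i\<in>A. f i x)" for f :: "'i \<Rightarrow> 'a \<Rightarrow> 'b::comm_monoid_add"
  by (induction A rule: infinite_finite_induct) (simp_all add: zero_fun_def plus_fun_def)

definition sublinear :: "('v::complex_vector \<Rightarrow> real) \<Rightarrow> bool" where
  "sublinear p \<longleftrightarrow> (\<forall>u v. p (u + v) \<le> p u + p v) \<and>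
     (\<forall>r u. r \<ge> 0 \<longrightarrow> p (complex_of_real r *\<^sub>C u) = r * p u)"

lemma sublinearD:
  assumes "sublinear p"
  shows "p (u + v) \<le> p u + p v" "r \<ge> 0 \<Longrightarrow> p (complex_of_real r *\<^sub>C u) = r * p u"
    "p 0 = 0" "- p (- u) \<le> p u"
proof -
  show 1: "p (u + v) \<le> p u + p v" "r \<ge> 0 \<Longrightarrow> p (complex_of_real r *\<^sub>C u) = r * p u" for u v r
    using assms by (auto simp: sublinear_def)
  show 0: "p 0 = 0" using 1(2)[of 0 0] by (simp add: scaleC_zero_left)
  show "- p (- u) \<le> p u" using 1(1)[of u "-u"] 0 by simp
qed

text \<open>
  The infimum of a chain of sublinear functionals below \<open>p\<close> is finite because each member
  \<open>g\<close> satisfies \<open>g v \<ge> - g (- v) \<ge> - p (- v)\<close>, and it is subadditive because two members of a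
  chain lie above a common one. So Zorn's lemma applies downwards. Minimal functionals turn out to be
  real linear, which gives the Hahn--Banach theorem without extending functionals one dimension at a
  time.
\<close>
lemma minimal_sublinear_exists:
  fixes p :: "'v::complex_vector \<Rightarrow> real"
  assumes p: "sublinear p"
  obtains g where "sublinear g" "g \<le> p" "\<And>h. sublinear h \<Longrightarrow> h \<le> g \<Longrightarrow> h = g"
proof -
  define A where "A = {g. sublinear g \<and> g \<le> p}"
  let ?P = "\<lambda>g h :: 'v \<Rightarrow> real. h \<le> g"
  have "\<exists>m\<in>A. \<forall>a\<in>A. ?P m a \<longrightarrow> a = m"
  proof (rule predicate_Zorn)
    show "partial_order_on A (relation_of ?P A)"
      by (rule partial_order_on_relation_ofI) auto
    fix C assume C: "C \<in> Chains (relation_of ?P A)"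
    have CA: "g \<in> A" if "g \<in> C" for g
      using C that by (auto simp: Chains_def relation_of_def)
    have lin: "g \<le> h \<or> h \<le> g" if "g \<in> C" "h \<in> C" for g h
      using C that by (auto simp: Chains_def relation_of_def)
    show "\<exists>u\<in>A. \<forall>a\<in>C. u \<le> a"
    proof (cases "C = {}")
      case True
      then show ?thesis using p by (auto simp: A_def)
    next
      case False
      define m where "m = (\<lambda>v. INF g\<in>C. g v)"
      have lower: "- p (- v) \<le> g v" if "g \<in> C" for g v
      proof -
        have "sublinear g" "g (- v) \<le> p (- v)" using CA[OF that] by (auto simp: A_def le_fun_def)
        then show ?thesis using sublinearD(4)[of g v] by linarith
      qed
      have bdd: "bdd_below ((\<lambda>g. g v) ` C)" for v
        using lower by (auto intro!: bdd_belowI2)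
      have m_le: "m v \<le> g v" if "g \<in> C" for g v
        unfolding m_def using bdd that by (rule cINF_lower)
      have le_m: "c \<le> m v" if "\<And>g. g \<in> C \<Longrightarrow> c \<le> g v" for c v
        unfolding m_def using False that by (rule cINF_greatest)
      have "m (u + v) \<le> m u + m v" for u v
      proof -
        have "m (u + v) \<le> g u + h v" if gh: "g \<in> C" "h \<in> C" for g h
        proof -
          obtain k where k: "k \<in> C" "k \<le> g" "k \<le> h" using lin[OF gh] gh by blast
          have "m (u + v) \<le> k (u + v)" by (rule m_le[OF k(1)])
          also have "\<dots> \<le> k u + k v" using CA[OF k(1)] sublinearD(1) by (auto simp: A_def)
          also have "\<dots> \<le> g u + h v" using k(2,3) by (simp add: le_fun_def add_mono)
          finally show ?thesis .
        qed
        then have "m (u + v) - h v \<le> m u" if "h \<in> C" for h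
          using that by (intro le_m) (simp add: algebra_simps)
        then have "m (u + v) - m u \<le> m v"
          by (intro le_m) (simp add: algebra_simps)
        then show ?thesis by simp
      qed
      moreover have "m (complex_of_real r *\<^sub>C u) = r * m u" if "r \<ge> 0" for r u
      proof (cases "r = 0")
        case True
        have "g 0 = 0" if "g \<in> C" for g using CA[OF that] sublinearD(3) by (auto simp: A_def)
        then have "m 0 = 0" using m_le[of _ 0] le_m[of 0 0] \<open>C \<noteq> {}\<close> by fastforce
        then show ?thesis using True by (simp add: scaleC_zero_left)
      next
        case False
        then have r: "r > 0" using that by simp
        have hom: "g (complex_of_real r *\<^sub>C u) = r * g u" if "g \<in> C" for g
          using CA[OF that] sublinearD(2) \<open>r \<ge> 0\<close> by (auto simp: A_def)
        have "m (complex_of_real r *\<^sub>C u) / r \<le> m u"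
          using m_le hom r by (intro le_m) (metis less_eq_real_def mult.commute pos_divide_le_eq)
        moreover have "r * m u \<le> m (complex_of_real r *\<^sub>C u)"
        proof (rule le_m)
          fix g assume g: "g \<in> C"
          show "r * m u \<le> g (complex_of_real r *\<^sub>C u)"
            using mult_left_mono[OF m_le[OF g, of u], of r] hom[OF g] r by simp
        qed
        ultimately show ?thesis using r by (simp add: field_simps)
      qed
      ultimately have "sublinear m" by (auto simp: sublinear_def)
      moreover have "m \<le> p"
      proof -
        obtain g where g: "g \<in> C" using False by blast
        have "g \<le> p" using CA[OF g] by (simp add: A_def)
        then show ?thesis using m_le[OF g] by (meson le_fun_def order_trans)
      qed
      ultimately show ?thesis using m_le by (intro bexI[of _ m]) (auto simp: A_def le_fun_def)
    qed
  qed
  then obtain g where "g \<in> A" and min: "\<And>h. h \<in> A \<Longrightarrow> h \<le> g \<Longrightarrow> h = g" by blast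
  then have "sublinear g" "g \<le> p" by (auto simp: A_def)
  then show thesis using min by (intro that) (auto simp: A_def)
qed

text \<open>
  The functional \<open>h v = inf {p (v + t a) - t p a | t \<ge> 0}\<close> is the largest sublinear functional below
  \<open>p\<close> with \<open>h (- a) \<le> - p a\<close>. It serves twice: a real linear functional below \<open>h\<close> attains the value
  \<open>p a\<close> at \<open>a\<close>, and if \<open>p\<close> is minimal then \<open>h = p\<close>, so \<open>p\<close> is odd.
\<close>
lemma sublinear_tilt:
  fixes p :: "'v::complex_vector \<Rightarrow> real"
  assumes p: "sublinear p"
  obtains h where "sublinear h" "h \<le> p" "h (- a) \<le> - p a"
proof -
  define S where "S v = {p (v + complex_of_real t *\<^sub>C a) - t * p a |t. t \<ge> 0}" for v
  define h where "h v = Inf (S v)" for v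
  have lower: "- p (- v) \<le> x" if x: "x \<in> S v" for x v
  proof -
    obtain t where t: "t \<ge> 0" "x = p (v + complex_of_real t *\<^sub>C a) - t * p a"
      using x by (auto simp: S_def)
    have "p (complex_of_real t *\<^sub>C a) \<le> p (v + complex_of_real t *\<^sub>C a) + p (- v)"
      using sublinearD(1)[OF p, of "v + complex_of_real t *\<^sub>C a" "- v"] by simp
    then show ?thesis using t sublinearD(2)[OF p] by simp
  qed
  have bdd: "bdd_below (S v)" for v unfolding bdd_below_def using lower by blast
  have ne: "S v \<noteq> {}" for v by (auto simp: S_def)
  have h_le: "h v \<le> p (v + complex_of_real t *\<^sub>C a) - t * p a" if "t \<ge> 0" for v t
    unfolding h_def by (rule cInf_lower[OF _ bdd]) (use that in \<open>auto simp: S_def\<close>)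
  have le_h: "c \<le> h v" if "\<And>t. t \<ge> 0 \<Longrightarrow> c \<le> p (v + complex_of_real t *\<^sub>C a) - t * p a" for c v
    unfolding h_def by (rule cInf_greatest[OF ne]) (use that in \<open>auto simp: S_def\<close>)
  have add: "h (u + v) \<le> h u + h v" for u v
  proof -
    have "h (u + v) \<le> (p (u + complex_of_real s *\<^sub>C a) - s * p a) +
        (p (v + complex_of_real t *\<^sub>C a) - t * p a)" if "s \<ge> 0" "t \<ge> 0" for s t
    proof -
      have "h (u + v) \<le> p ((u + v) + complex_of_real (s + t) *\<^sub>C a) - (s + t) * p a"
        using that by (intro h_le) simp
      also have "(u + v) + complex_of_real (s + t) *\<^sub>C a =
          (u + complex_of_real s *\<^sub>C a) + (v + complex_of_real t *\<^sub>C a)"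
        by (simp add: scaleC_add_left)
      also have "p \<dots> \<le> p (u + complex_of_real s *\<^sub>C a) + p (v + complex_of_real t *\<^sub>C a)"
        by (rule sublinearD(1)[OF p])
      finally show ?thesis by (simp add: algebra_simps)
    qed
    then have "h (u + v) - (p (v + complex_of_real t *\<^sub>C a) - t * p a) \<le> h u" if "t \<ge> 0" for t
      using that by (intro le_h) (simp add: algebra_simps)
    then have "h (u + v) - h u \<le> h v" by (intro le_h) (simp add: algebra_simps)
    then show ?thesis by simp
  qed
  have half: "h (complex_of_real r *\<^sub>C u) \<le> r * h u" if r: "r > 0" for r u
  proof -
    have "h (complex_of_real r *\<^sub>C u) / r \<le> h u"
    proof (rule le_h)
      fix t :: real assume t: "t \<ge> 0"
      have "h (complex_of_real r *\<^sub>C u) \<le>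
          p (complex_of_real r *\<^sub>C u + complex_of_real (r * t) *\<^sub>C a) - (r * t) * p a"
        using t r by (intro h_le) simp
      also have "complex_of_real r *\<^sub>C u + complex_of_real (r * t) *\<^sub>C a =
          complex_of_real r *\<^sub>C (u + complex_of_real t *\<^sub>C a)"
        by (simp add: scaleC_add_right scaleC_scaleC)
      also have "p \<dots> = r * p (u + complex_of_real t *\<^sub>C a)"
        using sublinearD(2)[OF p] r by simp
      finally show "h (complex_of_real r *\<^sub>C u) / r \<le> p (u + complex_of_real t *\<^sub>C a) - t * p a"
        using r by (simp add: field_simps)
    qed
    then show ?thesis using r by (simp add: field_simps)
  qed
  have h0: "h 0 = 0"
  proof (rule antisym)
    show "h 0 \<le> 0" using h_le[of 0 0] sublinearD(3)[OF p] by (simp add: scaleC_zero_left)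
    show "0 \<le> h 0" by (rule le_h) (use sublinearD(2)[OF p] in simp)
  qed
  have hom: "h (complex_of_real r *\<^sub>C u) = r * h u" if r: "r \<ge> 0" for r u
  proof (cases "r = 0")
    case True then show ?thesis by (simp add: scaleC_zero_left h0)
  next
    case False
    then have r: "r > 0" using r by simp
    have "h (complex_of_real (inverse r) *\<^sub>C complex_of_real r *\<^sub>C u) \<le>
        inverse r * h (complex_of_real r *\<^sub>C u)"
      using r by (intro half) simp
    also have "complex_of_real (inverse r) *\<^sub>C complex_of_real r *\<^sub>C u = u"
      using r by (simp add: scaleC_scaleC scaleC_one flip: of_real_mult)
    finally have "r * h u \<le> h (complex_of_real r *\<^sub>C u)" using r by (simp add: field_simps)
    then show ?thesis using half[OF r, of u] by simp
  qed
  show thesis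
  proof (rule that)
    show "sublinear h" using add hom by (simp add: sublinear_def)
    show "h \<le> p" unfolding le_fun_def
    proof
      fix v show "h v \<le> p v" using h_le[of 0 v] by (simp add: scaleC_zero_left)
    qed
    show "h (- a) \<le> - p a" using h_le[of 1 "- a"] sublinearD(3)[OF p] by (simp add: scaleC_one)
  qed
qed

lemma minimal_sublinear_additive:
  assumes g: "sublinear g" and min: "\<And>h. sublinear h \<Longrightarrow> h \<le> g \<Longrightarrow> h = g"
  shows "g (u + v) = g u + g v" "g (- u) = - g u"
proof -
  have neg: "g (- u) = - g u" for u
  proof -
    obtain h where "sublinear h" "h \<le> g" "h (- u) \<le> - g u" using sublinear_tilt[OF g] .
    with min show ?thesis using sublinearD(4)[OF g, of u] by fastforce
  qed
  show "g (- u) = - g u" by (rule neg)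
  have "g u \<le> g (u + v) - g v"
    using sublinearD(1)[OF g, of "u + v" "- v"] neg[of v] by simp
  then show "g (u + v) = g u + g v" using sublinearD(1)[OF g, of u v] by simp
qed

text \<open>
  A real linear \<open>g \<le> q\<close> with \<open>g a = q a\<close> is the real part of the complex linear functional
  \<open>\<Phi> u = g u - \<i> g (\<i> u)\<close>; a rotation that makes \<open>\<Phi> u\<close> a nonnegative real turns \<open>g \<le> q\<close> into
  \<open>\<bar>\<Phi>\<bar> \<le> q\<close>.
\<close>
proposition complex_Hahn_Banach_seminorm:
  fixes q :: "'v::complex_vector \<Rightarrow> real"
  assumes add: "\<And>u v. q (u + v) \<le> q u + q v"
    and hom: "\<And>c u. q (c *\<^sub>C u) = cmod c * q u"
  obtains \<Phi> :: "'v \<Rightarrow> complex"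
  where "\<And>u v. \<Phi> (u + v) = \<Phi> u + \<Phi> v" "\<And>c u. \<Phi> (c *\<^sub>C u) = c * \<Phi> u"
    "\<And>u. cmod (\<Phi> u) \<le> q u" "q a \<le> cmod (\<Phi> a)"
proof -
  have "sublinear q" using add hom by (simp add: sublinear_def)
  then obtain h where h: "sublinear h" "h \<le> q" "h (- a) \<le> - q a" using sublinear_tilt by blast
  obtain g where g: "sublinear g" "g \<le> h" "\<And>k. sublinear k \<Longrightarrow> k \<le> g \<Longrightarrow> k = g"
    using minimal_sublinear_exists[OF h(1)] by blast
  note gadd = minimal_sublinear_additive[OF g(1) g(3)]
  have gq: "g u \<le> q u" for u using g(2) h(2) by (meson le_fun_def order_trans)
  have ga: "q a \<le> g a"
    using g(2) h(3) gadd(2)[of a] by (smt (verit) le_fun_def)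
  have gscale: "g (complex_of_real r *\<^sub>C u) = r * g u" for r u
  proof (cases "r \<ge> 0")
    case True then show ?thesis using sublinearD(2)[OF g(1)] by simp
  next
    case False
    have "g (complex_of_real (- r) *\<^sub>C u) = (- r) * g u"
      using False by (intro sublinearD(2)[OF g(1)]) simp
    then show ?thesis by (simp add: scaleC_minus_left gadd(2))
  qed
  define \<Phi> where "\<Phi> u = Complex (g u) (- g (\<i> *\<^sub>C u))" for u
  have padd: "\<Phi> (u + v) = \<Phi> u + \<Phi> v" for u v
    by (simp add: \<Phi>_def gadd(1) scaleC_add_right complex_eq_iff)
  have phom: "\<Phi> (c *\<^sub>C u) = c * \<Phi> u" for c u
  proof -
    have "c = complex_of_real (Re c) + complex_of_real (Im c) * \<i>" by (simp add: complex_eq_iff)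
    then have "c *\<^sub>C u = complex_of_real (Re c) *\<^sub>C u + complex_of_real (Im c) *\<^sub>C \<i> *\<^sub>C u"
      by (metis scaleC_add_left scaleC_scaleC)
    then have 1: "g (c *\<^sub>C u) = Re c * g u + Im c * g (\<i> *\<^sub>C u)"
      by (simp add: gadd(1) gscale)
    have "\<i> * c = complex_of_real (Re c) * \<i> + complex_of_real (- Im c)" by (simp add: complex_eq_iff)
    then have "\<i> *\<^sub>C c *\<^sub>C u = complex_of_real (Re c) *\<^sub>C \<i> *\<^sub>C u + complex_of_real (- Im c) *\<^sub>C u"
      by (metis scaleC_add_left scaleC_scaleC)
    then have 2: "g (\<i> *\<^sub>C c *\<^sub>C u) = Re c * g (\<i> *\<^sub>C u) - Im c * g u"
      using gscale[of "- Im c" u] by (simp add: gadd(1) gscale)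
    show ?thesis by (simp add: \<Phi>_def 1 2 complex_eq_iff)
  qed
  have pq: "cmod (\<Phi> u) \<le> q u" for u
  proof (cases "\<Phi> u = 0")
    case True
    have "0 \<le> q u" using gq[of u] gq[of "- u"] gadd(2)[of u] hom[of "-1" u]
      by (simp add: scaleC_minus_one)
    then show ?thesis using True by simp
  next
    case False
    define c where "c = cnj (\<Phi> u) / complex_of_real (cmod (\<Phi> u))"
    have c: "cmod c = 1" using False by (simp add: c_def norm_divide)
    have "\<Phi> (c *\<^sub>C u) = complex_of_real (cmod (\<Phi> u))"
      using False by (simp add: phom c_def complex_norm_square[symmetric] power2_eq_square mult.commute)
    then have "cmod (\<Phi> u) = g (c *\<^sub>C u)" by (simp add: \<Phi>_def complex_eq_iff)
    also have "\<dots> \<le> q u" using gq[of "c *\<^sub>C u"] hom[of c u] c by simp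
    finally show ?thesis .
  qed
  have "q a \<le> cmod (\<Phi> a)" using ga complex_Re_le_cmod[of "\<Phi> a"] by (simp add: \<Phi>_def)
  with padd phom pq show thesis by (rule that)
qed

section \<open>Dual spaces of subspaces\<close>

lemma dual_spaceD:
  assumes "\<phi> \<in> dual_space V N"
  shows "x \<in> V \<Longrightarrow> y \<in> V \<Longrightarrow> \<phi> (x + y) = \<phi> x + \<phi> y" "x \<in> V \<Longrightarrow> \<phi> (c *\<^sub>C x) = c * \<phi> x"
    "x \<notin> V \<Longrightarrow> \<phi> x = 0" "\<exists>K\<ge>0. \<forall>x\<in>V. cmod (\<phi> x) \<le> K * \<bar>N x\<bar>"
proof -
  show "x \<in> V \<Longrightarrow> y \<in> V \<Longrightarrow> \<phi> (x + y) = \<phi> x + \<phi> y" "x \<in> V \<Longrightarrow> \<phi> (c *\<^sub>C x) = c * \<phi> x"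
    "x \<notin> V \<Longrightarrow> \<phi> x = 0"
    using assms
    by (auto simp: dual_space_def bounded_clinear_on_def clinear_on_def zero_off_def scaleC_complex_def)
  obtain K where K: "\<And>x. x \<in> V \<Longrightarrow> cmod (\<phi> x) \<le> K * N x"
    using assms by (auto simp: dual_space_def bounded_clinear_on_def)
  have "cmod (\<phi> x) \<le> \<bar>K\<bar> * \<bar>N x\<bar>" if "x \<in> V" for x
    using K[OF that] by (metis abs_ge_self abs_mult order_trans)
  then show "\<exists>K\<ge>0. \<forall>x\<in>V. cmod (\<phi> x) \<le> K * \<bar>N x\<bar>" by (metis abs_ge_zero)
qed

lemma mem_dualI:
  assumes "\<And>x y. x \<in> X \<Longrightarrow> y \<in> X \<Longrightarrow> \<phi> (x + y) = \<phi> x + \<phi> y"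
    and "\<And>c x. x \<in> X \<Longrightarrow> \<phi> (c *\<^sub>C x) = c * \<phi> x"
    and "\<And>x. x \<in> X \<Longrightarrow> cmod (\<phi> x) \<le> K * norm x" "\<And>x. x \<notin> X \<Longrightarrow> \<phi> x = 0"
  shows "\<phi> \<in> dual X"
  using assms
  by (auto simp: dual_space_def bounded_clinear_on_def clinear_on_def zero_off_def scaleC_complex_def
      intro!: exI[of _ K])

lemma csubspace_dual: "csubspace (dual X)"
  unfolding csubspace_def
proof (intro conjI ballI allI)
  show "0 \<in> dual X" by (rule mem_dualI[where K = 0]) auto
next
  fix \<phi> \<psi> assume *: "\<phi> \<in> dual X" "\<psi> \<in> dual X"
  obtain K L where "\<And>x. x \<in> X \<Longrightarrow> cmod (\<phi> x) \<le> K * norm x" "\<And>x. x \<in> X \<Longrightarrow> cmod (\<psi> x) \<le> L * norm x"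
    using dual_spaceD(4)[OF *(1)] dual_spaceD(4)[OF *(2)] by auto
  then have "cmod ((\<phi> + \<psi>) x) \<le> (K + L) * norm x" if "x \<in> X" for x
    using that by (smt (verit) norm_triangle_ineq plus_fun_def ring_class.ring_distribs(2))
  then show "\<phi> + \<psi> \<in> dual X"
    by (rule mem_dualI[rotated 2]) (auto simp: dual_spaceD[OF *(1)] dual_spaceD[OF *(2)] algebra_simps)
next
  fix c \<phi> assume *: "\<phi> \<in> dual X"
  obtain K where K: "\<And>x. x \<in> X \<Longrightarrow> cmod (\<phi> x) \<le> K * norm x"
    using dual_spaceD(4)[OF *] by auto
  have "cmod ((c *\<^sub>C \<phi>) x) \<le> (cmod c * K) * norm x" if "x \<in> X" for x
    using K[OF that] by (simp add: scaleC_fun_def scaleC_complex_def norm_mult mult.assoc mult_left_mono)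
  then show "c *\<^sub>C \<phi> \<in> dual X"
    by (rule mem_dualI[rotated 2])
      (auto simp: dual_spaceD[OF *] scaleC_fun_def scaleC_complex_def algebra_simps)
qed

lemma csubspace_sum: "csubspace V \<Longrightarrow> (\<And>i. i \<in> A \<Longrightarrow> f i \<in> V) \<Longrightarrow> sum f A \<in> V"
  by (induction A rule: infinite_finite_induct) (auto simp: csubspace_def)

lemma clinear_on_sum:
  assumes "csubspace V" "clinear_on V T" "\<And>i. i \<in> A \<Longrightarrow> f i \<in> V"
  shows "T (\<Sum>i\<in>A. c i *\<^sub>C f i) = (\<Sum>i\<in>A. c i *\<^sub>C T (f i))"
  using assms(3)
proof (induction A rule: infinite_finite_induct)
  case (insert i A)
  have "(\<Sum>i\<in>A. c i *\<^sub>C f i) \<in> V"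
    by (rule csubspace_sum) (use assms insert in \<open>auto simp: csubspace_def\<close>)
  moreover have "c i *\<^sub>C f i \<in> V" "f i \<in> V" using assms insert by (auto simp: csubspace_def)
  ultimately show ?case using insert assms(2) by (simp add: clinear_on_def)
next
  case empty
  have "T (0 *\<^sub>C 0) = 0 *\<^sub>C T 0" using assms(1,2) unfolding clinear_on_def csubspace_def by blast
  then show ?case by (simp add: scaleC_zero_left)
next
  case (infinite A)
  have "T (0 *\<^sub>C 0) = 0 *\<^sub>C T 0" using assms(1,2) unfolding clinear_on_def csubspace_def by blast
  then show ?case using infinite by (simp add: scaleC_zero_left)
qed

lemma dual_norm_bdd:
  assumes "\<phi> \<in> dual X"
  shows "bdd_above ((\<lambda>v. cmod (\<phi> v)) ` {v\<in>X. norm v \<le> 1})"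
proof -
  obtain K where K: "K \<ge> 0" "\<And>x. x \<in> X \<Longrightarrow> cmod (\<phi> x) \<le> K * norm x"
    using dual_spaceD(4)[OF assms] by auto
  show ?thesis
  proof (rule bdd_aboveI2)
    fix v assume v: "v \<in> {v\<in>X. norm v \<le> 1}"
    have "cmod (\<phi> v) \<le> K * norm v" using K v by simp
    also have "\<dots> \<le> K" using v K(1) by (simp add: mult_left_le)
    finally show "cmod (\<phi> v) \<le> K" .
  qed
qed

lemma dual_norm_nonneg:
  assumes "csubspace X" "\<phi> \<in> dual X"
  shows "0 \<le> dual_norm X norm \<phi>"
proof -
  have "cmod (\<phi> 0) \<le> dual_norm X norm \<phi>"
    unfolding dual_norm_def by (rule cSUP_upper[OF _ dual_norm_bdd[OF assms(2)]])
      (use assms(1) in \<open>auto simp: csubspace_def\<close>)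
  then show ?thesis using norm_ge_zero order_trans by blast
qed

lemma le_dual_norm:
  assumes "csubspace X" "\<phi> \<in> dual X" "x \<in> X"
  shows "cmod (\<phi> x) \<le> dual_norm X norm \<phi> * norm x"
proof (cases "x = 0")
  case True
  have "\<phi> (0 *\<^sub>C x) = 0" using dual_spaceD(2)[OF assms(2,3), of 0] by simp
  then show ?thesis using True by (simp add: scaleC_zero_left)
next
  case False
  define v where "v = complex_of_real (inverse (norm x)) *\<^sub>C x"
  have "v \<in> X" "norm v \<le> 1" using assms False by (auto simp: v_def csubspace_def norm_scaleC norm_inverse)
  then have "cmod (\<phi> v) \<le> dual_norm X norm \<phi>"
    unfolding dual_norm_def by (intro cSUP_upper dual_norm_bdd assms) auto
  moreover have "cmod (\<phi> v) = inverse (norm x) * cmod (\<phi> x)"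
    using assms by (simp add: v_def dual_spaceD(2)[OF assms(2)] norm_mult norm_inverse)
  ultimately show ?thesis using False by (simp add: field_simps)
qed

lemma dual_norm_almost_attained:
  assumes X: "csubspace X" and \<phi>: "\<phi> \<in> dual X" and "\<delta> > 0"
  obtains v where "v \<in> X" "norm v \<le> 1" "\<phi> v = complex_of_real (cmod (\<phi> v))"
    "dual_norm X norm \<phi> - \<delta> < cmod (\<phi> v)"
proof -
  have ne: "{v\<in>X. norm v \<le> 1} \<noteq> {}" using X by (auto simp: csubspace_def intro!: exI[of _ 0])
  obtain v where v: "v \<in> X" "norm v \<le> 1" "dual_norm X norm \<phi> - \<delta> < cmod (\<phi> v)"
    using less_cSUP_iff[OF ne dual_norm_bdd[OF \<phi>], of "dual_norm X norm \<phi> - \<delta>"] \<open>\<delta> > 0\<close>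
    by (auto simp: dual_norm_def)
  define c where "c = (if \<phi> v = 0 then 1 else cnj (\<phi> v) / complex_of_real (cmod (\<phi> v)))"
  have c: "cmod c = 1" by (auto simp: c_def norm_divide)
  have cv: "c * \<phi> v = complex_of_real (cmod (\<phi> v))"
    by (auto simp: c_def complex_norm_square[symmetric] power2_eq_square mult.commute)
  have "\<phi> (c *\<^sub>C v) = complex_of_real (cmod (\<phi> v))" using dual_spaceD(2)[OF \<phi> v(1)] cv by simp
  then show thesis
    using X v c by (intro that[of "c *\<^sub>C v"]) (auto simp: csubspace_def norm_scaleC)
qed

section \<open>Almost linear retractions\<close>

text \<open>
  This is the part of the principle of local reflexivity that concerns finitely many norm
  inequalities, with \<open>s\<close> in the role of the canonical embedding of the dual into the third dual. Fix
  bounds \<open>r j = norm (\<Sum> c j y y + a j) + e j\<close>. If no \<open>T\<close> works, then \<open>a\<close> has distance at least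
  \<open>1\<close> from the space of all tuples \<open>(\<Sum> c j y T y)\<^sub>j\<close> in the norm \<open>max norm (u j) / r j\<close>, and
  the Hahn--Banach theorem yields functionals \<open>\<phi> j\<close> on \<open>X\<close> with \<open>\<Sum> r j norm (\<phi> j) \<le> 1\<close>,
  \<open>\<Sum>\<^sub>j c j y \<phi> j = 0\<close> for every \<open>y\<close>, and \<open>\<bar>\<Sum> \<phi> j (a j)\<bar> \<ge> 1\<close>. The linear relations survive
  the application of \<open>s\<close>, so \<open>\<Sum> \<phi> j (a j) = \<Sum> s (\<phi> j) (\<Sum> c j y y + a j)\<close>, and this is at
  most \<open>\<Sum> norm (\<phi> j) (r j - e j) < 1\<close>.
\<close>
proposition local_reflexivity:
  fixes X :: "'y::complex_normed_vector set" and a :: "'j \<Rightarrow> 'y" and c :: "'j \<Rightarrow> 'y \<Rightarrow> complex"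
  assumes X: "csubspace X" and s: "isometric_extension_morphism X UNIV s"
    and J: "finite J" and S: "\<And>j. j \<in> J \<Longrightarrow> finite (S j)"
    and a: "\<And>j. j \<in> J \<Longrightarrow> a j \<in> X" and e: "\<And>j. j \<in> J \<Longrightarrow> e j > 0"
  shows "\<exists>T. (\<forall>y. T y \<in> X) \<and>
    (\<forall>j\<in>J. norm ((\<Sum>y\<in>S j. c j y *\<^sub>C T y) + a j) < norm ((\<Sum>y\<in>S j. c j y *\<^sub>C y) + a j) + e j)"
proof (rule ccontr)
  assume contra: "\<not> ?thesis"
  define A where "A T j = (\<Sum>y\<in>S j. c j y *\<^sub>C T y)" for T :: "'y \<Rightarrow> 'y" and j
  define r where "r j = norm ((\<Sum>y\<in>S j. c j y *\<^sub>C y) + a j) + e j" for j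
  have r: "r j > 0" if "j \<in> J" for j
    unfolding r_def using e[OF that] by (simp add: add_nonneg_pos)
  have Aadd: "A (\<lambda>y. T y + T' y) j = A T j + A T' j" for T T' j
    by (simp add: A_def scaleC_add_right sum.distrib)
  have Ascale: "A (\<lambda>y. k *\<^sub>C T y) j = k *\<^sub>C A T j" for k T j
    by (simp add: A_def scaleC_sum_right scaleC_scaleC mult.commute)
  have A0: "A (\<lambda>y. 0) j = 0" for j by (simp add: A_def scaleC_zero_right)
  \<comment> \<open>\<open>q\<close> is the distance to the space of tuples \<open>A T\<close>, taken on all of \<open>'j \<Rightarrow> 'y\<close>: the
      coordinates off \<open>J\<close> are invisible to it.\<close>
  define P where "P u t \<longleftrightarrow> t \<ge> 0 \<and> (\<exists>T. (\<forall>y. T y \<in> X) \<and> (\<forall>j\<in>J. norm (u j + A T j) \<le> t * r j))"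
    for u :: "'j \<Rightarrow> 'y" and t
  define q where "q u = Inf {t. P u t}" for u
  have X0: "0 \<in> X" and Xadd: "\<And>x y. x \<in> X \<Longrightarrow> y \<in> X \<Longrightarrow> x + y \<in> X"
    and Xscale: "\<And>k x. x \<in> X \<Longrightarrow> k *\<^sub>C x \<in> X" using X by (auto simp: csubspace_def)
  have Pex: "\<exists>t. P u t" for u
  proof -
    define t where "t = (\<Sum>j\<in>J. norm (u j) / r j)"
    have "norm (u j) / r j \<le> t" if "j \<in> J" for j
      unfolding t_def by (rule member_le_sum) (use that J r in \<open>auto simp: less_imp_le\<close>)
    then have "norm (u j) \<le> t * r j" if "j \<in> J" for j
      using that r by (simp add: pos_divide_le_eq)
    moreover have "t \<ge> 0" unfolding t_def by (rule sum_nonneg) (use r in \<open>auto simp: less_imp_le\<close>)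
    ultimately show ?thesis
      unfolding P_def using X0 by (intro exI[of _ t] conjI exI[of _ "\<lambda>y. 0"]) (auto simp: A0)
  qed
  have bdd: "bdd_below {t. P u t}" for u by (rule bdd_belowI[of _ 0]) (auto simp: P_def)
  have q_le: "q u \<le> t" if "P u t" for u t
    unfolding q_def by (rule cInf_lower[OF _ bdd]) (use that in auto)
  have le_q: "k \<le> q u" if "\<And>t. P u t \<Longrightarrow> k \<le> t" for k u
    unfolding q_def by (rule cInf_greatest) (use that Pex in auto)
  have Padd: "P (u + v) (t + t')" if uv: "P u t" "P v t'" for u v t t'
  proof -
    obtain T where T: "\<forall>y. T y \<in> X" "\<forall>j\<in>J. norm (u j + A T j) \<le> t * r j"
      using uv(1) by (auto simp: P_def)
    obtain T' where T': "\<forall>y. T' y \<in> X" "\<forall>j\<in>J. norm (v j + A T' j) \<le> t' * r j"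
      using uv(2) by (auto simp: P_def)
    have "norm ((u + v) j + A (\<lambda>y. T y + T' y) j) \<le> (t + t') * r j" if "j \<in> J" for j
    proof -
      have "(u + v) j + A (\<lambda>y. T y + T' y) j = (u j + A T j) + (v j + A T' j)"
        by (simp add: Aadd)
      then show ?thesis using T(2) T'(2) that
        by (smt (verit) norm_triangle_ineq ring_class.ring_distribs(2))
    qed
    then show ?thesis using uv T(1) T'(1) Xadd
      by (auto simp: P_def intro!: exI[of _ "\<lambda>y. T y + T' y"])
  qed
  have qadd: "q (u + v) \<le> q u + q v" for u v
  proof -
    have "q (u + v) - t \<le> q v" if "P u t" for t
      using q_le[OF Padd[OF that], of v] by (intro le_q) (simp add: algebra_simps)
    then have "q (u + v) - q v \<le> q u" by (intro le_q) (simp add: algebra_simps)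
    then show ?thesis by simp
  qed
  have Pscale: "P (k *\<^sub>C u) (cmod k * t)" if ut: "P u t" for k u t
  proof -
    obtain T where T: "\<forall>y. T y \<in> X" "\<forall>j\<in>J. norm (u j + A T j) \<le> t * r j"
      using ut by (auto simp: P_def)
    have "norm ((k *\<^sub>C u) j + A (\<lambda>y. k *\<^sub>C T y) j) \<le> (cmod k * t) * r j" if "j \<in> J" for j
    proof -
      have "(k *\<^sub>C u) j + A (\<lambda>y. k *\<^sub>C T y) j = k *\<^sub>C (u j + A T j)"
        by (simp add: Ascale scaleC_fun_def scaleC_add_right)
      then show ?thesis using T(2) that by (simp add: norm_scaleC mult.assoc mult_left_mono)
    qed
    then show ?thesis using ut T(1) Xscale
      by (auto simp: P_def intro!: exI[of _ "\<lambda>y. k *\<^sub>C T y"])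
  qed
  have qscale_le: "q (k *\<^sub>C u) \<le> cmod k * q u" for k u
  proof (cases "k = 0")
    case True
    obtain t where "P u t" using Pex by blast
    from q_le[OF Pscale[OF this, of k]] show ?thesis using True by simp
  next
    case False
    have "q (k *\<^sub>C u) / cmod k \<le> q u"
      using q_le[OF Pscale] False by (intro le_q) (simp add: field_simps)
    then show ?thesis using False by (simp add: field_simps)
  qed
  have qscale: "q (k *\<^sub>C u) = cmod k * q u" for k u
  proof (cases "k = 0")
    case True
    have "0 \<le> q (k *\<^sub>C u)" by (rule le_q) (simp add: P_def)
    then show ?thesis using qscale_le[of k u] True by simp
  next
    case False
    have "q (inverse k *\<^sub>C k *\<^sub>C u) \<le> cmod (inverse k) * q (k *\<^sub>C u)" by (rule qscale_le)
    then have "q u \<le> q (k *\<^sub>C u) / cmod k"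
      using False by (simp add: scaleC_scaleC scaleC_one norm_inverse divide_inverse mult.commute)
    then show ?thesis using qscale_le[of k u] False by (simp add: field_simps)
  qed
  have qa: "1 \<le> q a"
  proof (rule le_q, rule ccontr)
    fix t assume t: "P a t" "\<not> 1 \<le> t"
    then obtain T where T: "\<forall>y. T y \<in> X" "\<forall>j\<in>J. norm (a j + A T j) \<le> t * r j"
      by (auto simp: P_def)
    have "norm (A T j + a j) < r j" if "j \<in> J" for j
    proof -
      have "norm (A T j + a j) \<le> t * r j" using T(2) that by (simp add: add.commute)
      also have "\<dots> < r j" using t(2) r[OF that] by simp
      finally show ?thesis .
    qed
    then show False using contra T(1) unfolding A_def r_def by blast
  qed
  obtain \<Phi> :: "('j \<Rightarrow> 'y) \<Rightarrow> complex"
    where \<Phi>: "\<And>u v. \<Phi> (u + v) = \<Phi> u + \<Phi> v" "\<And>k u. \<Phi> (k *\<^sub>C u) = k * \<Phi> u"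
      "\<And>u. cmod (\<Phi> u) \<le> q u" "q a \<le> cmod (\<Phi> a)"
    using complex_Hahn_Banach_seminorm[of q a] qadd qscale by blast
  have \<Phi>sum: "\<Phi> (sum f I) = (\<Sum>i\<in>I. \<Phi> (f i))" for f :: "'j \<Rightarrow> 'j \<Rightarrow> 'y" and I
    using \<Phi>(1)[of 0 0] by (induction I rule: infinite_finite_induct) (simp_all add: \<Phi>(1))
  \<comment> \<open>Being dominated by \<open>q\<close>, \<open>\<Phi>\<close> depends on the coordinates in \<open>J\<close> only and kills every \<open>A T\<close>.\<close>
  define single where "single j x = (\<lambda>i. if i = j then x else 0)" for j :: 'j and x :: 'y
  define \<phi> where "\<phi> j = restr X (\<lambda>x. \<Phi> (single j x))" for j
  have split: "\<Phi> u = (\<Sum>j\<in>J. \<Phi> (single j (u j)))" for u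
  proof -
    have "cmod (\<Phi> (u - (\<Sum>j\<in>J. single j (u j)))) \<le> 0"
    proof (rule order_trans[OF \<Phi>(3)], rule q_le)
      have "(u - (\<Sum>j\<in>J. single j (u j))) i = 0" if "i \<in> J" for i
        using that J by (simp add: sum_fun_apply single_def)
      then show "P (u - (\<Sum>j\<in>J. single j (u j))) 0"
        using X0 by (auto simp: P_def A0 intro!: exI[of _ "\<lambda>y. 0"])
    qed
    then have 0: "\<Phi> (u - (\<Sum>j\<in>J. single j (u j))) = 0" by simp
    have "\<Phi> u = \<Phi> ((u - (\<Sum>j\<in>J. single j (u j))) + (\<Sum>j\<in>J. single j (u j)))" by simp
    also have "\<dots> = \<Phi> (\<Sum>j\<in>J. single j (u j))" by (simp only: \<Phi>(1) 0) simp
    finally show ?thesis by (simp add: \<Phi>sum)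
  qed
  have kill: "\<Phi> (A T) = 0" if "\<forall>y. T y \<in> X" for T
  proof -
    have "P (A T) 0"
      unfolding P_def
    proof (intro conjI exI[of _ "\<lambda>y. (-1) *\<^sub>C T y"])
      show "\<forall>y. (-1) *\<^sub>C T y \<in> X" using that Xscale by blast
      show "\<forall>j\<in>J. norm (A T j + A (\<lambda>y. (-1) *\<^sub>C T y) j) \<le> 0 * r j"
        unfolding Ascale by (simp add: scaleC_minus_one)
    qed simp
    then have "cmod (\<Phi> (A T)) \<le> 0" using \<Phi>(3) q_le order_trans by blast
    then show ?thesis by simp
  qed
  have sadd: "single j (x + y) = single j x + single j y" for j x y by (auto simp: single_def)
  have sscale: "single j (k *\<^sub>C x) = k *\<^sub>C single j x" for j x k
    by (auto simp: single_def scaleC_fun_def scaleC_zero_right)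
  have Psingle: "P (single j x) (norm x / r j)" if "j \<in> J" for j x
    unfolding P_def using X0 r r[OF that]
    by (intro conjI exI[of _ "\<lambda>y. 0"]) (auto simp: A0 single_def less_imp_le)
  have \<phi>dual: "\<phi> j \<in> dual X" if "j \<in> J" for j
  proof (rule mem_dualI[where K = "inverse (r j)"])
    fix x assume x: "x \<in> X"
    have "cmod (\<phi> j x) \<le> q (single j x)" using x \<Phi>(3) by (simp add: \<phi>_def restr_def)
    also have "\<dots> \<le> norm x / r j" by (rule q_le[OF Psingle[OF that]])
    finally show "cmod (\<phi> j x) \<le> inverse (r j) * norm x" by (simp add: field_simps)
  qed (use Xadd Xscale in \<open>auto simp: \<phi>_def restr_def sadd sscale \<Phi>\<close>)
  define n where "n j = dual_norm X norm (\<phi> j)" for j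
  have n0: "n j \<ge> 0" if "j \<in> J" for j using dual_norm_nonneg[OF X \<phi>dual[OF that]] by (simp add: n_def)
  \<comment> \<open>The dual of a weighted maximum norm is a weighted sum norm: test \<open>\<Phi>\<close> on a tuple whose
      coordinates almost attain the norms of the \<open>\<phi> j\<close>.\<close>
  have sum_le: "(\<Sum>j\<in>J. r j * n j) \<le> 1"
  proof (rule field_le_epsilon)
    fix \<epsilon> :: real assume \<epsilon>: "\<epsilon> > 0"
    define R where "R = 1 + (\<Sum>j\<in>J. r j)"
    have R: "R > 0" unfolding R_def by (smt (verit) r sum_nonneg)
    define \<delta> where "\<delta> = \<epsilon> / R"
    have \<delta>: "\<delta> > 0" using \<epsilon> R by (simp add: \<delta>_def)
    have "\<forall>j\<in>J. \<exists>v. v \<in> X \<and> norm v \<le> 1 \<and> \<phi> j v = complex_of_real (cmod (\<phi> j v)) \<and>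
      n j - \<delta> < cmod (\<phi> j v)"
      using dual_norm_almost_attained[OF X \<phi>dual \<delta>] unfolding n_def by metis
    then obtain v where v: "\<And>j. j \<in> J \<Longrightarrow> v j \<in> X" "\<And>j. j \<in> J \<Longrightarrow> norm (v j) \<le> 1"
      "\<And>j. j \<in> J \<Longrightarrow> \<phi> j (v j) = complex_of_real (cmod (\<phi> j (v j)))"
      "\<And>j. j \<in> J \<Longrightarrow> n j - \<delta> < cmod (\<phi> j (v j))" by metis
    define u where "u j = complex_of_real (r j) *\<^sub>C v j" for j
    have "P u 1"
      unfolding P_def using X0 r v(2)
      by (intro conjI exI[of _ "\<lambda>y. 0"]) (auto simp: A0 u_def norm_scaleC abs_of_pos)
    then have "cmod (\<Phi> u) \<le> 1" using \<Phi>(3) q_le order_trans by blast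
    moreover have "\<Phi> u = complex_of_real (\<Sum>j\<in>J. r j * cmod (\<phi> j (v j)))"
    proof -
      have "\<Phi> (single j (u j)) = complex_of_real (r j * cmod (\<phi> j (v j)))" if "j \<in> J" for j
      proof -
        have "\<Phi> (single j (u j)) = complex_of_real (r j) * \<phi> j (v j)"
          using v(1)[OF that] by (simp add: u_def sscale \<Phi>(2) \<phi>_def restr_def)
        then show ?thesis using v(3)[OF that] by simp
      qed
      then show ?thesis by (subst split) simp
    qed
    moreover have "(\<Sum>j\<in>J. r j * cmod (\<phi> j (v j))) \<ge> 0"
      by (intro sum_nonneg) (use r in \<open>auto simp: less_imp_le\<close>)
    ultimately have 1: "(\<Sum>j\<in>J. r j * cmod (\<phi> j (v j))) \<le> 1" by (simp del: of_real_sum)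
    have "(\<Sum>j\<in>J. r j * n j) \<le> (\<Sum>j\<in>J. r j * cmod (\<phi> j (v j)) + r j * \<delta>)"
    proof (rule sum_mono)
      fix j assume j: "j \<in> J"
      have "r j * n j \<le> r j * (cmod (\<phi> j (v j)) + \<delta>)"
        using v(4)[OF j] r[OF j] by (intro mult_left_mono) auto
      then show "r j * n j \<le> r j * cmod (\<phi> j (v j)) + r j * \<delta>" by (simp add: algebra_simps)
    qed
    also have "\<dots> = (\<Sum>j\<in>J. r j * cmod (\<phi> j (v j))) + (\<Sum>j\<in>J. r j) * \<delta>"
      by (simp add: sum.distrib sum_distrib_right)
    also have "\<dots> \<le> 1 + R * \<delta>" using 1 \<delta> by (intro add_mono mult_right_mono) (auto simp: R_def)
    also have "R * \<delta> = \<epsilon>" using R by (simp add: \<delta>_def)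
    finally show "(\<Sum>j\<in>J. r j * n j) \<le> 1 + \<epsilon>" .
  qed
  \<comment> \<open>Testing \<open>\<Phi> (A T) = 0\<close> on maps \<open>T\<close> supported at one point \<open>y\<close> gives one linear relation
      between the \<open>\<phi> j\<close> for each \<open>y\<close>; the coefficients are set to \<open>0\<close> off \<open>S j\<close> so that all sums can
      range over \<open>U\<close>.\<close>
  define U where "U = (\<Union>j\<in>J. S j)"
  define d where "d j y = (if y \<in> S j then c j y else 0)" for j y
  have finU: "finite U" using J S by (simp add: U_def)
  have relation: "(\<Sum>j\<in>J. d j y *\<^sub>C \<phi> j) = 0" for y
  proof
    fix x
    show "(\<Sum>j\<in>J. d j y *\<^sub>C \<phi> j) x = 0 x"
    proof (cases "x \<in> X")
      case True
      define T where "T z = (if z = y then x else 0)" for z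
      have "A T j = d j y *\<^sub>C x" if "j \<in> J" for j
      proof -
        have "A T j = (\<Sum>z\<in>S j. if z = y then c j z *\<^sub>C x else 0)"
          unfolding A_def T_def by (rule sum.cong) (auto simp: scaleC_zero_right)
        then show ?thesis using S[OF that] by (simp add: d_def scaleC_zero_left)
      qed
      then have "\<Phi> (A T) = (\<Sum>j\<in>J. d j y * \<phi> j x)"
        using True by (subst split) (simp add: sscale \<Phi>(2) \<phi>_def restr_def)
      moreover have "\<Phi> (A T) = 0" by (rule kill) (use True X0 in \<open>simp add: T_def\<close>)
      ultimately show ?thesis by (simp add: sum_fun_apply scaleC_fun_def scaleC_complex_def)
    next
      case False
      then show ?thesis
        by (simp add: sum_fun_apply scaleC_fun_def scaleC_complex_def \<phi>_def restr_def)
    qed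
  qed
  have slin: "clinear_on (dual X) s" and sUN: "\<And>\<psi>. \<psi> \<in> dual X \<Longrightarrow> s \<psi> \<in> dual UNIV"
    and snorm: "\<And>\<psi>. \<psi> \<in> dual X \<Longrightarrow> dual_norm UNIV norm (s \<psi>) = dual_norm X norm \<psi>"
    and sext: "\<And>\<psi> x. \<psi> \<in> dual X \<Longrightarrow> x \<in> X \<Longrightarrow> s \<psi> x = \<psi> x"
    using s by (auto simp: isometric_extension_morphism_def linear_isometry_on_def)
  have CU: "csubspace (UNIV :: 'y set)" by (simp add: csubspace_def)
  have srel: "(\<Sum>j\<in>J. d j y * s (\<phi> j) z) = 0" for y z
  proof -
    have "(\<Sum>j\<in>J. d j y *\<^sub>C s (\<phi> j)) = s (\<Sum>j\<in>J. d j y *\<^sub>C \<phi> j)"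
      by (rule clinear_on_sum[symmetric, OF csubspace_dual slin \<phi>dual])
    also have "\<dots> = s (\<Sum>j\<in>{}. d j y *\<^sub>C \<phi> j)" by (simp add: relation)
    also have "\<dots> = 0" by (subst clinear_on_sum[OF csubspace_dual slin]) auto
    finally have "(\<Sum>j\<in>J. d j y *\<^sub>C s (\<phi> j)) z = 0" by simp
    then show ?thesis by (simp add: sum_fun_apply scaleC_fun_def scaleC_complex_def)
  qed
  define b where "b j = (\<Sum>y\<in>S j. c j y *\<^sub>C y)" for j
  have sb: "s (\<phi> j) (b j) = (\<Sum>y\<in>U. d j y * s (\<phi> j) y)" if j: "j \<in> J" for j
  proof -
    have "clinear_on UNIV (s (\<phi> j))"
      using sUN[OF \<phi>dual[OF j]] by (simp add: dual_space_def bounded_clinear_on_def)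
    then have "s (\<phi> j) (b j) = (\<Sum>y\<in>S j. c j y *\<^sub>C s (\<phi> j) y)"
      unfolding b_def by (rule clinear_on_sum[OF CU]) simp
    also have "\<dots> = (\<Sum>y\<in>S j. d j y * s (\<phi> j) y)"
      by (rule sum.cong) (auto simp: d_def scaleC_complex_def)
    also have "\<dots> = (\<Sum>y\<in>U. d j y * s (\<phi> j) y)"
      by (rule sum.mono_neutral_left[OF finU]) (use j in \<open>auto simp: U_def d_def\<close>)
    finally show ?thesis .
  qed
  have "(\<Sum>j\<in>J. s (\<phi> j) (b j)) = (\<Sum>j\<in>J. \<Sum>y\<in>U. d j y * s (\<phi> j) y)" using sb by simp
  also have "\<dots> = (\<Sum>y\<in>U. \<Sum>j\<in>J. d j y * s (\<phi> j) y)" by (rule sum.swap)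
  also have "\<dots> = 0" by (simp add: srel)
  finally have b0: "(\<Sum>j\<in>J. s (\<phi> j) (b j)) = 0" .
  have "\<Phi> (single j (a j)) = s (\<phi> j) (a j)" if "j \<in> J" for j
    using sext[OF \<phi>dual[OF that] a[OF that]] a[OF that] by (simp add: \<phi>_def restr_def)
  then have "\<Phi> a = (\<Sum>j\<in>J. s (\<phi> j) (a j))" by (subst split) simp
  also have "\<dots> = (\<Sum>j\<in>J. s (\<phi> j) (b j + a j))"
    using b0 by (simp add: dual_spaceD(1)[OF sUN[OF \<phi>dual]] sum.distrib)
  finally have "cmod (\<Phi> a) \<le> (\<Sum>j\<in>J. cmod (s (\<phi> j) (b j + a j)))" by (simp add: norm_sum)
  also have "\<dots> \<le> (\<Sum>j\<in>J. n j * (r j - e j))"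
  proof (rule sum_mono)
    fix j assume j: "j \<in> J"
    show "cmod (s (\<phi> j) (b j + a j)) \<le> n j * (r j - e j)"
      using le_dual_norm[OF CU sUN[OF \<phi>dual[OF j]], of "b j + a j"] snorm[OF \<phi>dual[OF j]]
      by (simp add: r_def b_def n_def)
  qed
  also have "\<dots> = (\<Sum>j\<in>J. r j * n j) - (\<Sum>j\<in>J. n j * e j)"
    by (simp add: algebra_simps sum_subtractf)
  finally have 1: "1 \<le> (\<Sum>j\<in>J. r j * n j) - (\<Sum>j\<in>J. n j * e j)" using \<Phi>(4) qa by linarith
  have nn: "n j * e j \<ge> 0" if "j \<in> J" for j using n0[OF that] e[OF that] by simp
  have "(\<Sum>j\<in>J. n j * e j) \<le> 0" using 1 sum_le by linarith
  then have "\<forall>j\<in>J. n j * e j = 0"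
    using sum_nonneg_eq_0_iff[OF J nn] sum_nonneg[of J "\<lambda>j. n j * e j"] nn by force
  then have "n j = 0" if "j \<in> J" for j using e[OF that] that by force
  then show False using 1 by simp
qed

text \<open>
  Along such a filter the maps \<open>T\<close> take values in \<open>X\<close> and become linear, contractive and equal to the
  identity on \<open>X\<close>; each of these properties is an instance of the one family of norm inequalities.
  No single linear contraction onto \<open>X\<close> need exist.
\<close>
definition almost_linear_filter :: "'y::complex_normed_vector set \<Rightarrow> ('y \<Rightarrow> 'y) filter \<Rightarrow> bool" where
  "almost_linear_filter X \<FF> \<longleftrightarrow> \<FF> \<noteq> bot \<and> (\<forall>\<^sub>F T in \<FF>. \<forall>y. T y \<in> X) \<and>
     (\<forall>c S a. finite S \<longrightarrow> a \<in> X \<longrightarrow> (\<forall>e>0. \<forall>\<^sub>F T in \<FF>.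
        norm ((\<Sum>y\<in>S. c y *\<^sub>C T y) + a) < norm ((\<Sum>y\<in>S. c y *\<^sub>C y) + a) + e))"

lemma almost_linear_filter_exists:
  fixes X :: "'y::complex_normed_vector set"
  assumes X: "csubspace X" and s: "isometric_extension_morphism X UNIV s"
  shows "\<exists>\<FF>. almost_linear_filter X \<FF>"
proof -
  define I :: "(('y \<Rightarrow> complex) \<times> 'y set \<times> 'y \<times> real) set"
    where "I = {(c, S, a, e). finite S \<and> a \<in> X \<and> e > 0}"
  define B where "B = (\<lambda>(c, S, a, e). {T. (\<forall>y. T y \<in> X) \<and>
    norm ((\<Sum>y\<in>S. c y *\<^sub>C T y) + a) < norm ((\<Sum>y\<in>S. c y *\<^sub>C y) + a) + (e::real)})"
  define \<FF> where "\<FF> = (INF i\<in>I. principal (B i))"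
  have ev: "eventually Q \<FF>" if "i \<in> I" "\<And>T. T \<in> B i \<Longrightarrow> Q T" for i Q
  proof -
    have "\<FF> \<le> principal (B i)" unfolding \<FF>_def by (rule INF_lower[OF that(1)])
    then show ?thesis using that(2) unfolding le_principal by (auto elim: eventually_mono)
  qed
  have "\<FF> \<noteq> bot"
    unfolding \<FF>_def
  proof (rule INF_filter_not_bot)
    fix J assume J: "J \<subseteq> I" "finite J"
    have "\<exists>T. (\<forall>y. T y \<in> X) \<and> (\<forall>j\<in>J. norm ((\<Sum>y\<in>fst (snd j). fst j y *\<^sub>C T y) + fst (snd (snd j)))
        < norm ((\<Sum>y\<in>fst (snd j). fst j y *\<^sub>C y) + fst (snd (snd j))) + snd (snd (snd j)))"
      by (rule local_reflexivity[OF X s J(2)]) (use J(1) in \<open>auto simp: I_def\<close>)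
    then have "(\<Inter>i\<in>J. B i) \<noteq> {}" by (fastforce simp: B_def)
    then show "(INF i\<in>J. principal (B i)) \<noteq> bot"
      using J(2) by (simp add: INF_principal_finite principal_eq_bot_iff)
  qed
  moreover have "\<forall>\<^sub>F T in \<FF>. \<forall>y. T y \<in> X"
    by (rule ev[of "(\<lambda>_. 0, {}, 0, 1)"]) (use X in \<open>auto simp: I_def B_def csubspace_def\<close>)
  moreover have "\<forall>\<^sub>F T in \<FF>. norm ((\<Sum>y\<in>S. c y *\<^sub>C T y) + a) < norm ((\<Sum>y\<in>S. c y *\<^sub>C y) + a) + e"
    if "finite S" "a \<in> X" "e > 0" for c S a e
    by (rule ev[of "(c, S, a, e)"]) (use that in \<open>auto simp: I_def B_def\<close>)
  ultimately show ?thesis by (auto simp: almost_linear_filter_def)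
qed

section \<open>Compactness for families of bounded functions\<close>

text \<open>
  Tychonoff's theorem: the values lie in a product of closed discs. Passing to a finer filter replaces
  the choice of an ultrafilter.
\<close>
lemma common_convergent_subfilter:
  fixes \<Phi> :: "'i \<Rightarrow> 't \<Rightarrow> complex"
  assumes F: "\<FF> \<noteq> bot" and bd: "\<And>i. \<exists>B. \<forall>\<^sub>F t in \<FF>. cmod (\<Phi> i t) \<le> B"
  obtains \<GG> L where "\<GG> \<le> \<FF>" "\<GG> \<noteq> bot" "\<And>i. (\<Phi> i \<longlongrightarrow> L i) \<GG>"
proof -
  obtain B where B: "\<And>i. \<forall>\<^sub>F t in \<FF>. cmod (\<Phi> i t) \<le> B i" using bd by metis
  \<comment> \<open>The bounds hold only eventually, and not at the same time for all \<open>i\<close>, so values that exceed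
      their bound are replaced by \<open>0\<close>.\<close>
  define m where "m t = (\<lambda>i. if cmod (\<Phi> i t) \<le> B i then \<Phi> i t else 0)" for t
  define K where "K = (\<Pi>\<^sub>E i\<in>UNIV. cball (0::complex) \<bar>B i\<bar>)"
  have "compactin (product_topology (\<lambda>i::'i. euclidean :: complex topology) UNIV) K"
    unfolding K_def compactin_PiE by simp
  then have "compact K" by (simp add: euclidean_product_topology)
  moreover have "m t \<in> K" for t by (auto simp: m_def K_def)
  then have "\<forall>\<^sub>F z in filtermap m \<FF>. z \<in> K" by (simp add: eventually_filtermap)
  moreover have "filtermap m \<FF> \<noteq> bot" using F by (simp add: filtermap_bot_iff)
  ultimately obtain L where L: "inf (nhds L) (filtermap m \<FF>) \<noteq> bot"
    unfolding compact_filter by blast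
  define \<GG> where "\<GG> = inf \<FF> (filtercomap m (nhds L))"
  show thesis
  proof (rule that)
    show "\<GG> \<le> \<FF>" by (simp add: \<GG>_def)
    show "\<GG> \<noteq> bot"
    proof
      assume "\<GG> = bot"
      then have "\<forall>\<^sub>F t in \<GG>. False" by simp
      then obtain Q R where QR: "eventually Q \<FF>" "eventually R (filtercomap m (nhds L))"
        "\<And>t. Q t \<Longrightarrow> R t \<Longrightarrow> False"
        unfolding \<GG>_def eventually_inf by blast
      obtain R' where R': "eventually R' (nhds L)" "\<And>t. R' (m t) \<Longrightarrow> R t"
        using QR(2) by (auto simp: eventually_filtercomap)
      have "eventually (\<lambda>z. \<not> R' z) (filtermap m \<FF>)"
        unfolding eventually_filtermap using QR(1) by eventually_elim (use QR(3) R'(2) in blast)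
      then have "eventually (\<lambda>z. False) (inf (nhds L) (filtermap m \<FF>))"
        unfolding eventually_inf using R'(1) by blast
      then show False using L by (simp add: trivial_limit_def)
    qed
    fix i
    have "filterlim m (nhds L) \<GG>"
      unfolding \<GG>_def by (rule filterlim_mono[OF filterlim_filtercomap order_refl]) simp
    then have "((\<lambda>t. (\<lambda>z. z i) (m t)) \<longlongrightarrow> (\<lambda>z. z i) L) \<GG>"
      by (rule continuous_on_tendsto_compose[where s = UNIV and f = "\<lambda>z. z i",
            OF continuous_on_product_coordinates]) simp_all
    moreover have "\<forall>\<^sub>F t in \<GG>. m t i = \<Phi> i t"
      using filter_leD[OF \<open>\<GG> \<le> \<FF>\<close> B[of i]] by eventually_elim (simp add: m_def)
    ultimately show "(\<Phi> i \<longlongrightarrow> L i) \<GG>" by (rule Lim_transform_eventually)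
  qed
qed

section \<open>The Lipschitz constant\<close>

lemma zero_mem_unit_ball: "csubspace X \<Longrightarrow> 0 \<in> unit_ball X"
  by (auto simp: csubspace_def unit_ball_def)

lemma lip_const_bdd_above:
  assumes "f \<in> HL0 X"
  shows "bdd_above ((\<lambda>(x, y). cmod (f x - f y) / norm (x - y)) ` (unit_ball X \<times> unit_ball X))"
proof -
  obtain C where C: "C-lipschitz_on (unit_ball X) f" using assms by (auto simp: HL0_def)
  have "cmod (f x - f y) / norm (x - y) \<le> C" if "x \<in> unit_ball X" "y \<in> unit_ball X" for x y
  proof (cases "x = y")
    case True
    then show ?thesis using lipschitz_on_nonneg[OF C] by simp
  next
    case False
    then show ?thesis using lipschitz_onD[OF C that] by (simp add: dist_norm field_simps)
  qed
  then show ?thesis by (intro bdd_aboveI2[where M = C]) auto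
qed

lemma lip_const_bound:
  assumes "f \<in> HL0 X" "x \<in> unit_ball X" "y \<in> unit_ball X"
  shows "cmod (f x - f y) \<le> lip_const X f * norm (x - y)"
proof (cases "x = y")
  case False
  have "(case (x, y) of (x, y) \<Rightarrow> cmod (f x - f y) / norm (x - y)) \<le> lip_const X f"
    unfolding lip_const_def by (rule cSUP_upper[OF _ lip_const_bdd_above[OF assms(1)]])
      (use assms in auto)
  then show ?thesis using False by (simp add: pos_divide_le_eq)
qed simp

lemma lip_const_le:
  assumes "csubspace X" "C \<ge> 0"
    and "\<And>x y. x \<in> unit_ball X \<Longrightarrow> y \<in> unit_ball X \<Longrightarrow> cmod (f x - f y) \<le> C * norm (x - y)"
  shows "lip_const X f \<le> C"
  unfolding lip_const_def
proof (rule cSUP_least)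
  show "unit_ball X \<times> unit_ball X \<noteq> {}" using zero_mem_unit_ball[OF assms(1)] by blast
  fix p assume "p \<in> unit_ball X \<times> unit_ball X"
  then show "(case p of (x, y) \<Rightarrow> cmod (f x - f y) / norm (x - y)) \<le> C"
    using assms(2,3) by (cases "fst p = snd p") (auto simp: pos_divide_le_eq split: prod.split)
qed

section \<open>Holomorphic functions along complex lines\<close>

definition frechet_derivative_on_ball ::
  "'a::complex_normed_vector set \<Rightarrow> ('a \<Rightarrow> complex) \<Rightarrow> ('a \<Rightarrow> 'a \<Rightarrow> complex) \<Rightarrow> bool" where
  "frechet_derivative_on_ball X f D \<longleftrightarrow> (\<forall>x\<in>unit_ball X. D x \<in> dual X \<and>
     ((\<lambda>h. cmod (f (x + h) - f x - D x h) / norm h) \<longlongrightarrow> 0) (at 0 within X))"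

lemma derivative_along_line:
  assumes X: "csubspace X" and D: "frechet_derivative_on_ball X f D"
    and h: "h \<in> X" and z: "x + \<zeta> *\<^sub>C h \<in> unit_ball X"
  shows "((\<lambda>\<zeta>. f (x + \<zeta> *\<^sub>C h)) has_field_derivative D (x + \<zeta> *\<^sub>C h) h) (at \<zeta>)"
proof (cases "h = 0")
  case True
  have "D (x + \<zeta> *\<^sub>C h) \<in> dual X" using D z by (simp add: frechet_derivative_on_ball_def)
  from dual_spaceD(2)[OF this h, of 0] have "D (x + \<zeta> *\<^sub>C h) h = 0" using True by (simp add: scaleC_zero_left)
  then show ?thesis using True by (simp add: scaleC_zero_right)
next
  case False
  define z where "z = x + \<zeta> *\<^sub>C h"
  have Dz: "D z \<in> dual X" and
    lim: "((\<lambda>k. cmod (f (z + k) - f z - D z k) / norm k) \<longlongrightarrow> 0) (at 0 within X)"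
    using D[unfolded frechet_derivative_on_ball_def, rule_format, OF z] by (simp_all only: z_def)
  have "((\<lambda>k::complex. cmod k * norm h) \<longlongrightarrow> 0) (at 0)" by (auto intro!: tendsto_eq_intros)
  then have "((\<lambda>k. norm (k *\<^sub>C h)) \<longlongrightarrow> 0) (at 0)" by (simp only: norm_scaleC)
  then have lim0: "((\<lambda>k. k *\<^sub>C h) \<longlongrightarrow> 0) (at 0)" by (rule tendsto_norm_zero_cancel)
  have "k *\<^sub>C h \<noteq> 0" if "k \<noteq> 0" for k
    using that False norm_scaleC[of k h] norm_eq_zero[of "k *\<^sub>C h"] by simp
  moreover have "k *\<^sub>C h \<in> X" for k using X h by (simp add: csubspace_def)
  ultimately have "\<forall>\<^sub>F k in at 0. k *\<^sub>C h \<in> X \<and> k *\<^sub>C h \<noteq> 0"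
    unfolding eventually_at_filter by simp
  with lim0 have "filterlim (\<lambda>k. k *\<^sub>C h) (at 0 within X) (at 0)"
    unfolding filterlim_at by blast
  from filterlim_compose[OF lim this]
  have "((\<lambda>k. cmod (f (z + k *\<^sub>C h) - f z - D z (k *\<^sub>C h)) / norm (k *\<^sub>C h)) \<longlongrightarrow> 0) (at 0)" .
  then have "((\<lambda>k. cmod (f (z + k *\<^sub>C h) - f z - D z (k *\<^sub>C h)) / norm (k *\<^sub>C h) * norm h) \<longlongrightarrow> 0 * norm h) (at 0)"
    by (rule tendsto_mult_right)
  moreover have "\<forall>\<^sub>F k in at 0. cmod (f (z + k *\<^sub>C h) - f z - D z (k *\<^sub>C h)) / norm (k *\<^sub>C h) * norm h
      = cmod ((f (z + k *\<^sub>C h) - f z) / k - D z h)"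
    unfolding eventually_at_filter
  proof (intro always_eventually allI impI)
    fix k :: complex assume k: "k \<noteq> 0"
    have "(f (z + k *\<^sub>C h) - f z) / k - D z h = (f (z + k *\<^sub>C h) - f z - D z (k *\<^sub>C h)) / k"
      using k by (simp add: dual_spaceD(2)[OF Dz h] diff_divide_distrib)
    then show "cmod (f (z + k *\<^sub>C h) - f z - D z (k *\<^sub>C h)) / norm (k *\<^sub>C h) * norm h
      = cmod ((f (z + k *\<^sub>C h) - f z) / k - D z h)"
      using False by (simp add: norm_divide norm_scaleC)
  qed
  ultimately have "((\<lambda>k. cmod ((f (z + k *\<^sub>C h) - f z) / k - D z h)) \<longlongrightarrow> 0 * norm h) (at 0)"
    by (rule Lim_transform_eventually)
  then have "((\<lambda>k. (f (z + k *\<^sub>C h) - f z) / k - D z h) \<longlongrightarrow> 0) (at 0)"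
    unfolding mult_zero_left by (rule tendsto_norm_zero_cancel)
  then have "((\<lambda>k. (f (z + k *\<^sub>C h) - f z) / k) \<longlongrightarrow> D z h) (at 0)"
    by (rule LIM_zero_cancel)
  moreover have "x + (\<zeta> + k) *\<^sub>C h = z + k *\<^sub>C h" for k
    by (simp add: z_def scaleC_add_left add.assoc)
  ultimately show ?thesis
    unfolding DERIV_def by (simp add: z_def add.assoc)
qed

lemma lipschitz_derivative_bound:
  assumes X: "csubspace X" and D: "frechet_derivative_on_ball X f D"
    and lip: "\<And>x y. x \<in> unit_ball X \<Longrightarrow> y \<in> unit_ball X \<Longrightarrow> cmod (f x - f y) \<le> norm (x - y)"
    and x: "x \<in> unit_ball X" and h: "h \<in> X"
  shows "cmod (D x h) \<le> norm h"
proof -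
  have "((\<lambda>\<zeta>. f (x + \<zeta> *\<^sub>C h)) has_field_derivative D (x + 0 *\<^sub>C h) h) (at 0)"
    by (rule derivative_along_line[OF X D h]) (use x in \<open>simp add: scaleC_zero_left\<close>)
  then have "((\<lambda>k. (f (x + k *\<^sub>C h) - f x) / k) \<longlongrightarrow> D x h) (at 0)"
    by (simp add: DERIV_def scaleC_zero_left)
  moreover have "\<forall>\<^sub>F k in at 0. cmod ((f (x + k *\<^sub>C h) - f x) / k) \<le> norm h"
  proof -
    have "((\<lambda>k::complex. norm x + cmod k * norm h) \<longlongrightarrow> norm x) (at 0)"
      by (auto intro!: tendsto_eq_intros)
    then have "\<forall>\<^sub>F k in at 0. norm x + cmod k * norm h < 1"
      using x by (intro order_tendstoD) (auto simp: unit_ball_def)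
    moreover have "\<forall>\<^sub>F k::complex in at 0. k \<noteq> 0" by (simp add: eventually_at_filter)
    ultimately show ?thesis
    proof eventually_elim
      case (elim k)
      have "norm (x + k *\<^sub>C h) < 1"
        using elim(1) norm_triangle_ineq[of x "k *\<^sub>C h"] by (simp add: norm_scaleC)
      then have "x + k *\<^sub>C h \<in> unit_ball X" using X x h by (auto simp: unit_ball_def csubspace_def)
      then have "cmod (f (x + k *\<^sub>C h) - f x) \<le> cmod k * norm h"
        using lip[of "x + k *\<^sub>C h" x] x by (simp add: norm_scaleC)
      then show ?case using elim(2) by (simp add: norm_divide divide_simps mult.commute)
    qed
  qed
  ultimately show ?thesis by (intro Lim_norm_ubound[where net = "at (0::complex)"]) auto
qed

text \<open>
  What matters is that the constant depends on \<open>\<rho>\<close> only: the estimate then passes to pointwise limits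
  and forces them to be differentiable. On the line \<open>\<zeta> \<mapsto> x + \<zeta> h\<close> the function is holomorphic and
  bounded by \<open>1\<close> for \<open>\<bar>\<zeta>\<bar> < R = (1 - \<rho>) / norm h\<close>, so Cauchy's inequality on discs of radius
  \<open>R / 2\<close> bounds its second derivative on the unit disc by \<open>8 / R\<^sup>2\<close>, and Taylor's formula between
  \<open>0\<close> and \<open>1\<close> gives the claim.
\<close>
lemma uniform_second_order_bound:
  assumes X: "csubspace X" and D: "frechet_derivative_on_ball X f D"
    and bd: "\<And>x. x \<in> unit_ball X \<Longrightarrow> cmod (f x) \<le> 1"
    and x: "x \<in> X" "norm x \<le> \<rho>" and \<rho>: "\<rho> < 1" and h: "h \<in> X" "norm h \<le> (1 - \<rho>) / 3"
  shows "cmod (f (x + h) - f x - D x h) \<le> 8 / (1 - \<rho>)\<^sup>2 * (norm h)\<^sup>2"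
proof (cases "h = 0")
  case True
  have "D x \<in> dual X" using D x \<rho> by (auto simp: frechet_derivative_on_ball_def unit_ball_def)
  from dual_spaceD(2)[OF this h(1), of 0] show ?thesis using True by (simp add: scaleC_zero_left)
next
  case False
  define R where "R = (1 - \<rho>) / norm h"
  have R: "R \<ge> 3" using h(2) False by (simp add: R_def field_simps)
  define g where "g = (\<lambda>\<zeta>. f (x + \<zeta> *\<^sub>C h))"
  have mem: "x + \<zeta> *\<^sub>C h \<in> unit_ball X" if "cmod \<zeta> < R" for \<zeta>
  proof -
    have "cmod \<zeta> * norm h < 1 - \<rho>" using that False by (simp add: R_def field_simps)
    then have "norm (x + \<zeta> *\<^sub>C h) < 1"
      using x(2) norm_triangle_ineq[of x "\<zeta> *\<^sub>C h"] by (simp add: norm_scaleC)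
    then show ?thesis using X x h by (auto simp: unit_ball_def csubspace_def)
  qed
  have gder: "(g has_field_derivative D (x + \<zeta> *\<^sub>C h) h) (at \<zeta>)" if "cmod \<zeta> < R" for \<zeta>
    unfolding g_def by (rule derivative_along_line[OF X D h(1) mem[OF that]])
  have hol: "g holomorphic_on ball 0 R"
    unfolding holomorphic_on_open[OF open_ball] using gder by (metis mem_ball_0)
  have B: "cmod ((deriv ^^ 2) g \<zeta>) \<le> fact 2 * 1 / (R / 2) ^ 2" if \<zeta>: "\<zeta> \<in> cball 0 1" for \<zeta>
  proof (rule Cauchy_inequality)
    have sub: "cball \<zeta> (R / 2) \<subseteq> ball 0 R"
    proof
      fix w assume "w \<in> cball \<zeta> (R / 2)"
      then have "cmod (\<zeta> - w) \<le> R / 2" by (simp add: dist_norm)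
      moreover have "cmod w \<le> cmod \<zeta> + cmod (\<zeta> - w)"
        by (metis norm_minus_commute norm_triangle_sub)
      ultimately show "w \<in> ball 0 R" using \<zeta> R by simp
    qed
    show "g holomorphic_on ball \<zeta> (R / 2)"
      using holomorphic_on_subset[OF hol] sub ball_subset_cball by blast
    show "continuous_on (cball \<zeta> (R / 2)) g"
      using holomorphic_on_subset[OF hol sub] by (rule holomorphic_on_imp_continuous_on)
    show "0 < R / 2" using R by simp
    fix w assume "cmod (\<zeta> - w) = R / 2"
    then have "w \<in> ball 0 R" using sub by (auto simp: dist_norm)
    then show "cmod (g w) \<le> 1" using bd mem by (simp add: g_def)
  qed
  have "cmod ((deriv ^^ 0) g 1 - (\<Sum>i\<le>1. (deriv ^^ i) g 0 * (1 - 0) ^ i / fact i))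
      \<le> (fact 2 * 1 / (R / 2) ^ 2) * cmod (1 - 0) ^ Suc 1 / fact 1"
  proof (rule complex_Taylor[where S = "cball 0 1"])
    fix i and w :: complex assume w: "w \<in> cball 0 1"
    have "(deriv ^^ i) g holomorphic_on ball 0 R"
      by (rule holomorphic_higher_deriv[OF hol]) simp
    then have "((deriv ^^ i) g has_field_derivative deriv ((deriv ^^ i) g) w) (at w)"
      by (rule holomorphic_derivI) (use w R in auto)
    then show "((deriv ^^ i) g has_field_derivative (deriv ^^ Suc i) g w) (at w within cball 0 1)"
      by (simp add: has_field_derivative_at_within)
  next
    fix w :: complex assume "w \<in> cball 0 1"
    from B[OF this] show "cmod ((deriv ^^ Suc 1) g w) \<le> fact 2 * 1 / (R / 2) ^ 2"
      by (simp add: numeral_2_eq_2)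
  qed auto
  moreover have "deriv g 0 = D x h"
    using DERIV_imp_deriv[OF gder[of 0]] R by (simp add: scaleC_zero_left)
  ultimately have "cmod (g 1 - g 0 - D x h) \<le> 8 / R\<^sup>2"
    by (simp add: power2_eq_square field_simps)
  then show ?thesis
    using False by (simp add: g_def R_def scaleC_zero_left scaleC_one power_divide)
qed

section \<open>Extending holomorphic Lipschitz functions\<close>

text \<open>
  The form in which the defining property is used; the points \<open>u\<close>, \<open>v\<close>, \<open>w\<close> may coincide, and then
  their coefficients add up.
\<close>
lemma almost_linear_filter_three_terms:
  assumes F: "almost_linear_filter X \<FF>" and x: "x \<in> X" and e: "e > 0"
  shows "\<forall>\<^sub>F T in \<FF>. norm (\<alpha> *\<^sub>C T u + \<beta> *\<^sub>C T v + \<gamma> *\<^sub>C T w + x)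
    < norm (\<alpha> *\<^sub>C u + \<beta> *\<^sub>C v + \<gamma> *\<^sub>C w + x) + e"
proof -
  define c where "c z = (if z = u then \<alpha> else 0) + (if z = v then \<beta> else 0) + (if z = w then \<gamma> else 0)" for z
  have if_scale: "(if P then k else 0) *\<^sub>C y = (if P then k *\<^sub>C y else 0)" for P k and y :: 'a
    by (simp add: scaleC_zero_left)
  have "(\<Sum>z\<in>{u, v, w}. c z *\<^sub>C T z) = \<alpha> *\<^sub>C T u + \<beta> *\<^sub>C T v + \<gamma> *\<^sub>C T w" for T :: "'a \<Rightarrow> 'a"
    unfolding c_def scaleC_add_left if_scale sum.distrib by (subst sum.delta, simp)+ simp
  note combination = this
  have "finite {u, v, w}" by simp
  with F x e have "\<forall>\<^sub>F T in \<FF>. norm ((\<Sum>z\<in>{u, v, w}. c z *\<^sub>C T z) + x)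
      < norm ((\<Sum>z\<in>{u, v, w}. c z *\<^sub>C z) + x) + e"
    unfolding almost_linear_filter_def by blast
  then show ?thesis unfolding combination combination[of "\<lambda>z. z"] .
qed

text \<open>
  The extension is \<open>F y = lim f (T y)\<close> and its derivative is \<open>E y h = lim D (T y) (T h)\<close>, both limits
  taken along a finer filter on which they exist. Linearity of \<open>E y\<close>, the bounds \<open>\<bar>F y - F z\<bar> \<le>
  norm (y - z)\<close> and \<open>\<bar>E y h\<bar> \<le> norm h\<close>, and the second order estimate are pointwise closed conditions,
  so they are inherited from \<open>f\<close>, \<open>D\<close> up to errors such as \<open>norm (T (y + h) - T y - T h)\<close>, which tend
  to \<open>0\<close>. The maps \<open>T\<close> need not be continuous, so this does not follow from a theorem on limits of
  holomorphic functions.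
\<close>
lemma holomorphic_lipschitz_extension:
  fixes X :: "'y::complex_normed_vector set"
  assumes X: "csubspace X" and FF: "almost_linear_filter X \<FF>" and f: "f \<in> HL0_ball X"
  obtains F where "F \<in> HL0_ball UNIV" "restr (unit_ball X) F = f"
proof -
  have fHL: "f \<in> HL0 X" using f by (simp add: HL0_ball_def)
  have lip: "cmod (f x - f y) \<le> norm (x - y)" if "x \<in> unit_ball X" "y \<in> unit_ball X" for x y
    using lip_const_bound[OF fHL that] f mult_right_mono[of "lip_const X f" 1 "norm (x - y)"]
    by (simp add: HL0_ball_def)
  have f0: "f 0 = 0" and foff: "\<And>x. x \<notin> unit_ball X \<Longrightarrow> f x = 0"
    using fHL by (auto simp: HL0_def zero_off_def)
  have fbd: "cmod (f x) \<le> 1" for x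
    using lip[OF _ zero_mem_unit_ball[OF X], of x] f0 foff[of x]
    by (cases "x \<in> unit_ball X") (auto simp: unit_ball_def)
  have "\<forall>x\<in>unit_ball X. \<exists>D. D \<in> dual X \<and>
     ((\<lambda>h. cmod (f (x + h) - f x - D h) / norm h) \<longlongrightarrow> 0) (at 0 within X)"
    using fHL by (auto simp: HL0_def holomorphic_on_ball_def)
  then obtain D' where D': "\<forall>x\<in>unit_ball X. D' x \<in> dual X \<and>
     ((\<lambda>h. cmod (f (x + h) - f x - D' x h) / norm h) \<longlongrightarrow> 0) (at 0 within X)" by metis
  \<comment> \<open>The points \<open>T y\<close> lie in the ball only eventually; the value \<open>0\<close> elsewhere keeps \<open>D x\<close> in the
      dual, with norm at most \<open>1\<close>, for every \<open>x\<close>.\<close>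
  define D where "D x = (if x \<in> unit_ball X then D' x else 0)" for x
  have D: "frechet_derivative_on_ball X f D" using D' by (simp add: frechet_derivative_on_ball_def D_def)
  have Ddual: "D x \<in> dual X" for x
    using D' csubspace_dual[of X] by (auto simp: D_def csubspace_def)
  have Dbd: "cmod (D x h) \<le> norm h" if "h \<in> X" for x h
    using lipschitz_derivative_bound[OF X D lip _ that, of x] by (cases "x \<in> unit_ball X") (auto simp: D_def)
  have X0: "0 \<in> X" and Xdiff: "\<And>x y. x \<in> X \<Longrightarrow> y \<in> X \<Longrightarrow> x - y \<in> X"
    and Xadd: "\<And>x y. x \<in> X \<Longrightarrow> y \<in> X \<Longrightarrow> x + y \<in> X"
    and Xscale: "\<And>k x. x \<in> X \<Longrightarrow> k *\<^sub>C x \<in> X"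
    using X unfolding csubspace_def by (auto, metis add.commute scaleC_minus_one uminus_add_conv_diff)

  have Tnorm: "\<forall>\<^sub>F T in \<HH>. norm (T y) < norm y + e"
    if "almost_linear_filter X \<HH>" "e > 0" for \<HH> y e
    using almost_linear_filter_three_terms[OF that(1) X0 that(2), of 1 y 0 y 0 y]
    by (simp add: scaleC_zero_left scaleC_one)
  have "\<exists>B. \<forall>\<^sub>F T in \<FF>. cmod (case_sum (\<lambda>y T. f (T y)) (\<lambda>(y, h) T. D (T y) (T h)) i T) \<le> B" for i
  proof (cases i)
    case (Inl y)
    then show ?thesis using fbd by (auto intro!: exI[of _ 1])
  next
    case (Inr p)
    obtain y h where p: "p = (y, h)" by (cases p)
    have "\<forall>\<^sub>F T in \<FF>. \<forall>y. T y \<in> X" using FF by (simp add: almost_linear_filter_def)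
    with Tnorm[OF FF zero_less_one, of h]
    have "\<forall>\<^sub>F T in \<FF>. cmod (D (T y) (T h)) \<le> norm h + 1"
    proof eventually_elim
      case (elim T)
      then have "cmod (D (T y) (T h)) \<le> norm (T h)" by (intro Dbd) simp
      then show ?case using elim by simp
    qed
    then show ?thesis using Inr p by auto
  qed
  moreover have "\<FF> \<noteq> bot" using FF by (simp add: almost_linear_filter_def)
  ultimately obtain \<GG> L where GG: "\<GG> \<le> \<FF>" "\<GG> \<noteq> bot"
    and L: "\<And>i. (case_sum (\<lambda>y T. f (T y)) (\<lambda>(y, h) T. D (T y) (T h)) i \<longlongrightarrow> L i) \<GG>"
    using common_convergent_subfilter[of \<FF> "case_sum (\<lambda>y T. f (T y)) (\<lambda>(y, h) T. D (T y) (T h))"] by blast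
  have G: "almost_linear_filter X \<GG>"
    using FF GG filter_leD[OF GG(1)] unfolding almost_linear_filter_def by blast
  define F where "F y = L (Inl y)" for y
  define E where "E y h = L (Inr (y, h))" for y h
  have Flim: "((\<lambda>T. f (T y)) \<longlongrightarrow> F y) \<GG>" for y using L[of "Inl y"] by (simp add: F_def)
  have Elim: "((\<lambda>T. D (T y) (T h)) \<longlongrightarrow> E y h) \<GG>" for y h using L[of "Inr (y, h)"] by (simp add: E_def)
  have TX: "\<forall>\<^sub>F T in \<GG>. \<forall>y. T y \<in> X" using G by (simp add: almost_linear_filter_def)
  note Tn = Tnorm[OF G]
  have Tball: "\<forall>\<^sub>F T in \<GG>. T y \<in> unit_ball X" if "norm y < 1" for y
  proof -
    have "0 < 1 - norm y" using that by simp
    from Tn[OF this, of y] TX show ?thesis by eventually_elim (simp add: unit_ball_def)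
  qed
  have zero_limit: "(\<psi> \<longlongrightarrow> 0) \<GG>" if "\<And>e. e > 0 \<Longrightarrow> \<forall>\<^sub>F T in \<GG>. norm (\<psi> T) < e"
    for \<psi> :: "('y \<Rightarrow> 'y) \<Rightarrow> 'y"
    using that by (simp add: tendsto_iff)
  have Tadd: "((\<lambda>T. T (y + z) - T y - T z) \<longlongrightarrow> 0) \<GG>" for y z
    using almost_linear_filter_three_terms[OF G X0, of _ 1 "y + z" "-1" y "-1" z]
    by (intro zero_limit) (simp add: scaleC_one scaleC_minus_one)
  have Tscale: "((\<lambda>T. T (k *\<^sub>C y) - k *\<^sub>C T y) \<longlongrightarrow> 0) \<GG>" for k y
    using almost_linear_filter_three_terms[OF G X0, of _ 1 "k *\<^sub>C y" "- k" y 0 0]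
    by (intro zero_limit) (simp add: scaleC_one scaleC_minus_left scaleC_zero_left)
  have Tdiff: "\<forall>\<^sub>F T in \<GG>. norm (T y - T z) < norm (y - z) + e" if "e > 0" for y z e
    using almost_linear_filter_three_terms[OF G X0 that, of 1 y "-1" z 0 0]
    by (simp add: scaleC_one scaleC_minus_one scaleC_zero_left)
  have Tid: "((\<lambda>T. T x - x) \<longlongrightarrow> 0) \<GG>" if "x \<in> X" for x
    using almost_linear_filter_three_terms[OF G, of "- x" _ 1 x 0 0 0 0] Xdiff[OF X0 that]
    by (intro zero_limit) (simp add: scaleC_one scaleC_zero_left)

  have Fext: "F x = f x" if x: "x \<in> unit_ball X" for x
  proof -
    have "((\<lambda>T. f (T x) - f x) \<longlongrightarrow> 0) \<GG>"
    proof (rule Lim_null_comparison)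
      have "norm x < 1" using x by (simp add: unit_ball_def)
      from Tball[OF this] show "\<forall>\<^sub>F T in \<GG>. cmod (f (T x) - f x) \<le> norm (T x - x)"
        by eventually_elim (use lip x in blast)
      show "((\<lambda>T. norm (T x - x)) \<longlongrightarrow> 0) \<GG>"
        using Tid x by (auto intro: tendsto_norm_zero simp: unit_ball_def)
    qed
    then have "((\<lambda>T. f (T x)) \<longlongrightarrow> f x) \<GG>" by (simp add: LIM_zero_iff)
    then show ?thesis using tendsto_unique[OF GG(2) Flim] by blast
  qed
  have Flip: "cmod (F y - F z) \<le> norm (y - z)" if "norm y < 1" "norm z < 1" for y z
  proof (rule field_le_epsilon)
    fix e :: real assume e: "e > 0"
    have "\<forall>\<^sub>F T in \<GG>. cmod (f (T y) - f (T z)) \<le> norm (y - z) + e"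
      using Tball[OF that(1)] Tball[OF that(2)] Tdiff[OF e, of y z]
      by eventually_elim (use lip in fastforce)
    then show "cmod (F y - F z) \<le> norm (y - z) + e"
      by (rule Lim_norm_ubound[OF GG(2) tendsto_diff[OF Flim Flim]])
  qed
  have Ddiff: "D x (u - v) = D x u - D x v" if "u \<in> X" "v \<in> X" for x u v
    using dual_spaceD(1)[OF Ddual Xdiff[OF that] that(2), of x] by simp
  have Dscale: "D x (k *\<^sub>C u) = k * D x u" if "u \<in> X" for x u k
    by (rule dual_spaceD(2)[OF Ddual that])
  have Eadd: "E y (h + k) = E y h + E y k" for y h k
  proof -
    have "((\<lambda>T. D (T y) (T (h + k)) - D (T y) (T h) - D (T y) (T k)) \<longlongrightarrow> 0) \<GG>"
    proof (rule Lim_null_comparison)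
      show "\<forall>\<^sub>F T in \<GG>. cmod (D (T y) (T (h + k)) - D (T y) (T h) - D (T y) (T k))
          \<le> norm (T (h + k) - T h - T k)"
        using TX
      proof eventually_elim
        case (elim T)
        then have "D (T y) (T (h + k)) - D (T y) (T h) - D (T y) (T k) = D (T y) (T (h + k) - T h - T k)"
          by (simp add: Ddiff Xdiff)
        then show ?case using Dbd elim Xdiff by metis
      qed
      show "((\<lambda>T. norm (T (h + k) - T h - T k)) \<longlongrightarrow> 0) \<GG>" by (rule tendsto_norm_zero[OF Tadd])
    qed
    moreover have "((\<lambda>T. D (T y) (T (h + k)) - D (T y) (T h) - D (T y) (T k)) \<longlongrightarrow>
        E y (h + k) - E y h - E y k) \<GG>" by (intro tendsto_diff Elim)
    ultimately have "E y (h + k) - E y h - E y k = 0" using tendsto_unique[OF GG(2)] by blast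
    then show ?thesis by (simp add: algebra_simps)
  qed
  have Escale: "E y (c *\<^sub>C h) = c * E y h" for y h c
  proof -
    have "((\<lambda>T. D (T y) (T (c *\<^sub>C h)) - c * D (T y) (T h)) \<longlongrightarrow> 0) \<GG>"
    proof (rule Lim_null_comparison)
      show "\<forall>\<^sub>F T in \<GG>. cmod (D (T y) (T (c *\<^sub>C h)) - c * D (T y) (T h)) \<le> norm (T (c *\<^sub>C h) - c *\<^sub>C T h)"
        using TX
      proof eventually_elim
        case (elim T)
        then have "D (T y) (T (c *\<^sub>C h)) - c * D (T y) (T h) = D (T y) (T (c *\<^sub>C h) - c *\<^sub>C T h)"
          by (simp add: Ddiff Dscale Xscale)
        then show ?case using Dbd elim Xdiff Xscale by metis
      qed
      show "((\<lambda>T. norm (T (c *\<^sub>C h) - c *\<^sub>C T h)) \<longlongrightarrow> 0) \<GG>" by (rule tendsto_norm_zero[OF Tscale])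
    qed
    moreover have "((\<lambda>T. D (T y) (T (c *\<^sub>C h)) - c * D (T y) (T h)) \<longlongrightarrow> E y (c *\<^sub>C h) - c * E y h) \<GG>"
      by (intro tendsto_diff tendsto_mult_left Elim)
    ultimately have "E y (c *\<^sub>C h) - c * E y h = 0" using tendsto_unique[OF GG(2)] by blast
    then show ?thesis by simp
  qed
  have Ebd: "cmod (E y h) \<le> norm h" for y h
  proof (rule field_le_epsilon)
    fix e :: real assume e: "e > 0"
    have "\<forall>\<^sub>F T in \<GG>. cmod (D (T y) (T h)) \<le> norm h + e"
      using TX Tn[OF e, of h]
    proof eventually_elim
      case (elim T)
      then have "cmod (D (T y) (T h)) \<le> norm (T h)" by (intro Dbd) simp
      then show ?case using elim by simp
    qed
    then show "cmod (E y h) \<le> norm h + e" by (rule Lim_norm_ubound[OF GG(2) Elim])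
  qed
  have second: "cmod (F (y + h) - F y - E y h) \<le> 32 / (1 - norm y)\<^sup>2 * (norm h)\<^sup>2"
    if y: "norm y < 1" and h: "norm h < (1 - norm y) / 6" for y h
  proof -
    \<comment> \<open>The points \<open>T y\<close> may have norm slightly larger than \<open>norm y\<close>; \<open>\<rho>\<close> leaves room for that.\<close>
    define \<rho> where "\<rho> = (1 + norm y) / 2"
    define C where "C = 32 / (1 - norm y)\<^sup>2"
    have \<rho>: "norm y < \<rho>" "\<rho> < 1" "norm h < (1 - \<rho>) / 3" using y h by (auto simp: \<rho>_def field_simps)
    have C: "C = 8 / (1 - \<rho>)\<^sup>2" using y by (simp add: C_def \<rho>_def power2_eq_square field_simps)
    have C0: "C \<ge> 0" by (simp add: C_def)
    have Ty: "\<forall>\<^sub>F T in \<GG>. norm (T y) < \<rho>" and Th: "\<forall>\<^sub>F T in \<GG>. norm (T h) < (1 - \<rho>) / 3"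
      using Tn[of "\<rho> - norm y" y] Tn[of "(1 - \<rho>) / 3 - norm h" h] \<rho> by simp_all
    have yh: "norm (y + h) < 1" using norm_triangle_ineq[of y h] h y by simp
    have close: "((\<lambda>T. f (T (y + h)) - f (T y + T h)) \<longlongrightarrow> 0) \<GG>"
    proof (rule Lim_null_comparison)
      show "\<forall>\<^sub>F T in \<GG>. cmod (f (T (y + h)) - f (T y + T h)) \<le> norm (T (y + h) - T y - T h)"
        using Tball[OF yh] TX Ty Th
      proof eventually_elim
        case (elim T)
        have "norm (T y + T h) < 1"
          using elim \<rho> norm_triangle_ineq[of "T y" "T h"] by (simp add: field_simps)
        then have "T y + T h \<in> unit_ball X" using elim Xadd by (simp add: unit_ball_def)
        from lip[OF elim(1) this] show ?case by (simp add: algebra_simps)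
      qed
      show "((\<lambda>T. norm (T (y + h) - T y - T h)) \<longlongrightarrow> 0) \<GG>" by (rule tendsto_norm_zero[OF Tadd])
    qed
    have "((\<lambda>T. f (T (y + h)) - (f (T (y + h)) - f (T y + T h))) \<longlongrightarrow> F (y + h) - 0) \<GG>"
      by (intro tendsto_diff Flim close)
    then have lim1: "((\<lambda>T. f (T y + T h)) \<longlongrightarrow> F (y + h)) \<GG>" by simp
    have lim2: "((\<lambda>T. f (T y + T h) - f (T y) - D (T y) (T h)) \<longlongrightarrow> F (y + h) - F y - E y h) \<GG>"
      by (intro tendsto_diff lim1 Flim Elim)
    have bound: "cmod (F (y + h) - F y - E y h) \<le> C * (norm h + e)\<^sup>2" if e: "e > 0" for e
    proof (rule Lim_norm_ubound[OF GG(2) lim2])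
      show "\<forall>\<^sub>F T in \<GG>. cmod (f (T y + T h) - f (T y) - D (T y) (T h)) \<le> C * (norm h + e)\<^sup>2"
        using TX Ty Th Tn[OF e, of h]
      proof eventually_elim
        case (elim T)
        have "cmod (f (T y + T h) - f (T y) - D (T y) (T h)) \<le> C * (norm (T h))\<^sup>2"
          unfolding C using elim \<rho>
          by (intro uniform_second_order_bound[OF X D fbd]) auto
        also have "\<dots> \<le> C * (norm h + e)\<^sup>2"
          using elim C0 by (intro mult_left_mono power_mono) auto
        finally show ?case .
      qed
    qed
    have "((\<lambda>e. C * (norm h + e)\<^sup>2) \<longlongrightarrow> C * (norm h + 0)\<^sup>2) (at_right 0)"
      by (intro tendsto_intros)
    then have "cmod (F (y + h) - F y - E y h) \<le> C * (norm h + 0)\<^sup>2"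
      by (rule tendsto_lowerbound) (use bound in \<open>auto simp: eventually_at_filter\<close>)
    then show ?thesis by (simp add: C_def)
  qed
  have Edual: "E y \<in> dual UNIV" for y
    by (rule mem_dualI[where K = 1]) (auto simp: Eadd Escale Ebd)

  define H where "H = restr (unit_ball UNIV) F"
  have HF: "H y = F y" if "norm y < 1" for y using that by (simp add: H_def restr_def unit_ball_def)
  have Hlip: "cmod (H y - H z) \<le> 1 * norm (y - z)" if "y \<in> unit_ball UNIV" "z \<in> unit_ball UNIV" for y z
    using Flip[of y z] that by (simp add: HF unit_ball_def)
  have "holomorphic_on_ball UNIV H"
    unfolding holomorphic_on_ball_def
  proof
    fix y :: 'y assume "y \<in> unit_ball UNIV"
    then have y: "norm y < 1" by (simp add: unit_ball_def)
    have "((\<lambda>h. cmod (H (y + h) - H y - E y h) / norm h) \<longlongrightarrow> 0) (at 0)"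
    proof (rule Lim_null_comparison)
      show "((\<lambda>h. 32 / (1 - norm y)\<^sup>2 * norm h) \<longlongrightarrow> 0) (at (0::'y))"
        using y by (auto intro!: tendsto_eq_intros)
      have "\<forall>\<^sub>F h in at (0::'y). norm h < (1 - norm y) / 6"
        unfolding eventually_at by (rule exI[of _ "(1 - norm y) / 6"]) (use y in auto)
      then show "\<forall>\<^sub>F h in at 0. norm (cmod (H (y + h) - H y - E y h) / norm h)
          \<le> 32 / (1 - norm y)\<^sup>2 * norm h"
      proof eventually_elim
        case (elim h)
        have "norm (y + h) < 1" using norm_triangle_ineq[of y h] elim y by simp
        then have le: "cmod (H (y + h) - H y - E y h) \<le> 32 / (1 - norm y)\<^sup>2 * (norm h)\<^sup>2"
          using second[OF y elim] y by (simp only: HF)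
        show ?case
        proof (cases "h = 0")
          case False
          then show ?thesis using divide_right_mono[OF le, of "norm h"] by (simp add: power2_eq_square)
        qed simp
      qed
    qed
    with Edual show "\<exists>D\<in>dual UNIV. ((\<lambda>h. cmod (H (y + h) - H y - D h) / norm h) \<longlongrightarrow> 0) (at 0)"
      by blast
  qed
  moreover have "1-lipschitz_on (unit_ball UNIV) H"
    by (rule lipschitz_onI) (use Hlip in \<open>auto simp: dist_norm\<close>)
  moreover have "H 0 = 0" using Fext[OF zero_mem_unit_ball[OF X]] f0 by (simp add: HF)
  moreover have "zero_off (unit_ball UNIV) H" by (simp add: H_def restr_def zero_off_def)
  ultimately have "H \<in> HL0 UNIV" by (auto simp: HL0_def)
  moreover have "lip_const UNIV H \<le> 1"
    by (rule lip_const_le) (use Hlip in \<open>auto simp: csubspace_def\<close>)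
  moreover have "restr (unit_ball X) H = f"
  proof
    fix x show "restr (unit_ball X) H x = f x"
      using Fext[of x] foff[of x] HF[of x] by (auto simp: restr_def unit_ball_def)
  qed
  ultimately show thesis by (intro that[of H]) (simp_all add: HL0_ball_def)
qed

section \<open>Restriction to the smaller ball and the predual\<close>

lemma lip_const_nonneg:
  assumes "csubspace X" "f \<in> HL0 X"
  shows "0 \<le> lip_const X f"
proof -
  have "(case (0, 0) of (x, y) \<Rightarrow> cmod (f x - f y) / norm (x - y)) \<le> lip_const X f"
    unfolding lip_const_def
    by (rule cSUP_upper[OF _ lip_const_bdd_above[OF assms(2)]]) (simp add: zero_mem_unit_ball[OF assms(1)])
  then show ?thesis by simp
qed

lemma HL0_add:
  assumes f: "f \<in> HL0 X" and g: "g \<in> HL0 X"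
  shows "f + g \<in> HL0 X"
proof -
  obtain C where C: "C-lipschitz_on (unit_ball X) f" using f by (auto simp: HL0_def)
  obtain C' where C': "C'-lipschitz_on (unit_ball X) g" using g by (auto simp: HL0_def)
  have "(C + C')-lipschitz_on (unit_ball X) (f + g)"
    using lipschitz_on_add[OF C C'] by (simp add: plus_fun_def)
  moreover have "holomorphic_on_ball X (f + g)"
    unfolding holomorphic_on_ball_def
  proof
    fix x assume x: "x \<in> unit_ball X"
    obtain D where D: "D \<in> dual X"
      "((\<lambda>h. cmod (f (x + h) - f x - D h) / norm h) \<longlongrightarrow> 0) (at 0 within X)"
      using f x by (auto simp: HL0_def holomorphic_on_ball_def)
    obtain E where E: "E \<in> dual X"
      "((\<lambda>h. cmod (g (x + h) - g x - E h) / norm h) \<longlongrightarrow> 0) (at 0 within X)"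
      using g x by (auto simp: HL0_def holomorphic_on_ball_def)
    have "((\<lambda>h. cmod ((f + g) (x + h) - (f + g) x - (D + E) h) / norm h) \<longlongrightarrow> 0) (at 0 within X)"
    proof (rule Lim_null_comparison)
      show "((\<lambda>h. cmod (f (x + h) - f x - D h) / norm h + cmod (g (x + h) - g x - E h) / norm h) \<longlongrightarrow> 0)
          (at 0 within X)" using tendsto_add[OF D(2) E(2)] by simp
      have "cmod ((f + g) (x + h) - (f + g) x - (D + E) h)
          \<le> cmod (f (x + h) - f x - D h) + cmod (g (x + h) - g x - E h)" for h
        using norm_triangle_ineq[of "f (x + h) - f x - D h" "g (x + h) - g x - E h"]
        by (simp add: algebra_simps)
      then show "\<forall>\<^sub>F h in at 0 within X. norm (cmod ((f + g) (x + h) - (f + g) x - (D + E) h) / norm h)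
          \<le> cmod (f (x + h) - f x - D h) / norm h + cmod (g (x + h) - g x - E h) / norm h"
        by (intro always_eventually allI) (simp add: divide_right_mono flip: add_divide_distrib)
    qed
    moreover have "D + E \<in> dual X" using D(1) E(1) csubspace_dual[of X] by (auto simp: csubspace_def)
    ultimately show "\<exists>D\<in>dual X. ((\<lambda>h. cmod ((f + g) (x + h) - (f + g) x - D h) / norm h) \<longlongrightarrow> 0) (at 0 within X)"
      by blast
  qed
  ultimately show ?thesis using f g by (auto simp: HL0_def zero_off_def)
qed

lemma HL0_scaleC:
  assumes f: "f \<in> HL0 X"
  shows "c *\<^sub>C f \<in> HL0 X"
proof -
  have cf: "(c *\<^sub>C g) x = c * g x" for g :: "'a \<Rightarrow> complex" and x
    by (simp add: scaleC_fun_def scaleC_complex_def)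
  obtain C where C: "C-lipschitz_on (unit_ball X) f" using f by (auto simp: HL0_def)
  have "(cmod c * C)-lipschitz_on (unit_ball X) (c *\<^sub>C f)"
  proof (rule lipschitz_onI)
    fix x y assume xy: "x \<in> unit_ball X" "y \<in> unit_ball X"
    have "dist ((c *\<^sub>C f) x) ((c *\<^sub>C f) y) = cmod c * dist (f x) (f y)"
      by (simp add: cf dist_norm norm_mult flip: right_diff_distrib)
    also have "\<dots> \<le> cmod c * (C * dist x y)"
      by (intro mult_left_mono lipschitz_onD[OF C xy]) simp
    finally show "dist ((c *\<^sub>C f) x) ((c *\<^sub>C f) y) \<le> cmod c * C * dist x y" by (simp add: mult.assoc)
  qed (use lipschitz_on_nonneg[OF C] in simp)
  moreover have "holomorphic_on_ball X (c *\<^sub>C f)"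
    unfolding holomorphic_on_ball_def
  proof
    fix x assume x: "x \<in> unit_ball X"
    obtain D where D: "D \<in> dual X"
      "((\<lambda>h. cmod (f (x + h) - f x - D h) / norm h) \<longlongrightarrow> 0) (at 0 within X)"
      using f x by (auto simp: HL0_def holomorphic_on_ball_def)
    have "cmod ((c *\<^sub>C f) (x + h) - (c *\<^sub>C f) x - (c *\<^sub>C D) h) / norm h
        = cmod c * (cmod (f (x + h) - f x - D h) / norm h)" for h
      by (simp add: cf norm_mult flip: right_diff_distrib)
    then have "((\<lambda>h. cmod ((c *\<^sub>C f) (x + h) - (c *\<^sub>C f) x - (c *\<^sub>C D) h) / norm h) \<longlongrightarrow> 0) (at 0 within X)"
      using tendsto_mult_right_zero[OF D(2), of "cmod c"] by (simp only:)
    moreover have "c *\<^sub>C D \<in> dual X" using D(1) csubspace_dual[of X] by (auto simp: csubspace_def)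
    ultimately show "\<exists>D\<in>dual X. ((\<lambda>h. cmod ((c *\<^sub>C f) (x + h) - (c *\<^sub>C f) x - D h) / norm h) \<longlongrightarrow> 0) (at 0 within X)"
      by blast
  qed
  ultimately show ?thesis using f by (auto simp: HL0_def zero_off_def cf)
qed

lemma lip_const_restr_le:
  assumes X: "csubspace X" "csubspace Y" "X \<subseteq> Y" and f: "f \<in> HL0 Y"
  shows "lip_const X (restr (unit_ball X) f) \<le> lip_const Y f"
  by (rule lip_const_le[OF X(1) lip_const_nonneg[OF X(2) f]])
    (use lip_const_bound[OF f] X(3) in \<open>auto simp: restr_def unit_ball_def\<close>)

lemma restr_HL0_ball:
  assumes X: "csubspace X" "csubspace Y" "X \<subseteq> Y" and f: "f \<in> HL0_ball Y"
  shows "restr (unit_ball X) f \<in> HL0_ball X"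
  using f lip_const_restr_le[OF X, of f] restr_unit_ball_HL0[OF X(1,3), of f]
  by (auto simp: HL0_ball_def)

lemma topspace_tau0: "topspace (tau0 X) = HL0 X"
proof
  show "topspace (tau0 X) \<subseteq> HL0 X"
    by (auto simp: topspace_def openin_tau0 tau0_open_def)
  have "tau0_open X (HL0 X)"
    unfolding tau0_open_def
    by (auto simp: tau0_nhd_def intro!: exI[of _ "{}"] exI[of _ "1::real"])
  then show "HL0 X \<subseteq> topspace (tau0 X)" by (simp add: openin_subset openin_tau0)
qed

lemma continuous_map_restr_tau0:
  assumes X: "csubspace X" "X \<subseteq> Y"
  shows "continuous_map (tau0 Y) (tau0 X) (restr (unit_ball X))"
  unfolding continuous_map_def topspace_tau0
proof (intro conjI allI impI)
  show "restr (unit_ball X) \<in> HL0 Y \<rightarrow> HL0 X" using restr_unit_ball_HL0[OF X] by blast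
  fix U assume U: "openin (tau0 X) U"
  show "openin (tau0 Y) {f \<in> HL0 Y. restr (unit_ball X) f \<in> U}"
    unfolding openin_tau0 tau0_open_def
  proof (intro conjI ballI)
    fix f assume "f \<in> {f \<in> HL0 Y. restr (unit_ball X) f \<in> U}"
    then have f: "f \<in> HL0 Y" "restr (unit_ball X) f \<in> U" by auto
    obtain K e where K: "compact K" "K \<subseteq> unit_ball X" "e > 0" "tau0_nhd X (restr (unit_ball X) f) K e \<subseteq> U"
      using U f(2) unfolding openin_tau0 tau0_open_def by blast
    have "tau0_nhd Y f K e \<subseteq> {f \<in> HL0 Y. restr (unit_ball X) f \<in> U}"
    proof
      fix g assume g: "g \<in> tau0_nhd Y f K e"
      have "restr (unit_ball X) g' x = g' x" if "x \<in> K" for g' :: "'a \<Rightarrow> complex" and x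
        using that K(2) by (auto simp: restr_def)
      with g have "restr (unit_ball X) g \<in> tau0_nhd X (restr (unit_ball X) f) K e"
        using restr_unit_ball_HL0[OF X] by (simp add: tau0_nhd_def)
      then show "g \<in> {f \<in> HL0 Y. restr (unit_ball X) f \<in> U}" using K(4) g by (auto simp: tau0_nhd_def)
    qed
    moreover have "K \<subseteq> unit_ball Y" using K(2) X(2) by (auto simp: unit_ball_def)
    ultimately show "\<exists>K e. compact K \<and> K \<subseteq> unit_ball Y \<and> e > 0 \<and>
        tau0_nhd Y f K e \<subseteq> {f \<in> HL0 Y. restr (unit_ball X) f \<in> U}"
      using K(1,3) by blast
  qed auto
qed

lemma restr_add: "restr A (f + g) = restr A f + (restr A g :: 'a \<Rightarrow> complex)"
  by (auto simp: restr_def)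

lemma restr_scaleC: "restr A (c *\<^sub>C f) = c *\<^sub>C (restr A f :: 'a \<Rightarrow> complex)"
  by (auto simp: restr_def scaleC_fun_def scaleC_complex_def)

lemma rho_mem_G0:
  assumes X: "csubspace X" "csubspace Y" "X \<subseteq> Y" and \<phi>: "\<phi> \<in> G0 X"
  shows "rho X Y \<phi> \<in> G0 Y"
proof -
  let ?R = "restr (unit_ball X)"
  have \<phi>d: "\<phi> \<in> dual_space (HL0 X) (lip_const X)"
    and \<phi>c: "continuous_map (subtopology (tau0 X) (HL0_ball X)) euclidean \<phi>"
    using \<phi> by (auto simp: G0_def HL0_dual_def)
  have R: "?R f \<in> HL0 X" if "f \<in> HL0 Y" for f using restr_unit_ball_HL0[OF X(1,3) that] .
  have rho: "rho X Y \<phi> f = \<phi> (?R f)" if "f \<in> HL0 Y" for f using that by (simp add: rho_def restr_def)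
  obtain K where K: "K \<ge> 0" "\<And>g. g \<in> HL0 X \<Longrightarrow> cmod (\<phi> g) \<le> K * \<bar>lip_const X g\<bar>"
    using dual_spaceD(4)[OF \<phi>d] by auto
  have bound: "cmod (rho X Y \<phi> f) \<le> K * lip_const Y f" if f: "f \<in> HL0 Y" for f
  proof -
    have "cmod (rho X Y \<phi> f) \<le> K * \<bar>lip_const X (?R f)\<bar>" using K(2)[OF R[OF f]] rho[OF f] by simp
    also have "\<dots> \<le> K * lip_const Y f"
      using lip_const_restr_le[OF X f] lip_const_nonneg[OF X(1) R[OF f]] K(1) by (intro mult_left_mono) auto
    finally show ?thesis .
  qed
  have "rho X Y \<phi> \<in> HL0_dual Y"
    unfolding HL0_dual_def dual_space_def bounded_clinear_on_def clinear_on_def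
  proof (rule CollectI, intro conjI ballI allI)
    show "rho X Y \<phi> ` HL0 Y \<subseteq> UNIV" by simp
  next
    fix f g assume fg: "f \<in> HL0 Y" "g \<in> HL0 Y"
    show "rho X Y \<phi> (f + g) = rho X Y \<phi> f + rho X Y \<phi> g"
      using fg HL0_add[OF fg] R dual_spaceD(1)[OF \<phi>d] by (simp add: rho restr_add)
  next
    fix c f assume f: "f \<in> HL0 Y"
    show "rho X Y \<phi> (c *\<^sub>C f) = c *\<^sub>C rho X Y \<phi> f"
      using f HL0_scaleC[OF f] R dual_spaceD(2)[OF \<phi>d] by (simp add: rho restr_scaleC scaleC_complex_def)
  next
    show "\<exists>K. \<forall>x\<in>HL0 Y. cmod (rho X Y \<phi> x) \<le> K * lip_const Y x" using bound by blast
    show "zero_off (HL0 Y) (rho X Y \<phi>)" by (simp add: rho_def restr_def zero_off_def)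
  qed
  moreover have "continuous_map (subtopology (tau0 Y) (HL0_ball Y)) euclidean (rho X Y \<phi>)"
  proof (rule continuous_map_eq)
    have "continuous_map (subtopology (tau0 Y) (HL0_ball Y)) (subtopology (tau0 X) (HL0_ball X)) ?R"
      using restr_HL0_ball[OF X]
      by (auto simp: continuous_map_in_subtopology
          intro!: continuous_map_from_subtopology continuous_map_restr_tau0[OF X(1,3)])
    then show "continuous_map (subtopology (tau0 Y) (HL0_ball Y)) euclidean (\<phi> \<circ> ?R)"
      using \<phi>c by (rule continuous_map_compose)
  qed (simp add: topspace_tau0 rho)
  ultimately show ?thesis by (simp add: G0_def)
qed

theorem corollary4p7:
  fixes X :: "'y::complex_banach set"
    and s :: "('y \<Rightarrow> complex) \<Rightarrow> ('y \<Rightarrow> complex)"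
  assumes "csubspace X" and "closed X"
    and "symmetrically_regular X"
    and "isometric_extension_morphism X UNIV s"
  shows "linear_isometry_on (G0 X) (G0_norm X) (G0 UNIV) (G0_norm UNIV) (rho X UNIV)"
  unfolding linear_isometry_on_def
proof (intro conjI ballI)
  note X = assms(1)
  have U: "csubspace (UNIV :: 'y set)" by (simp add: csubspace_def)
  show "rho X UNIV ` G0 X \<subseteq> G0 UNIV" using rho_mem_G0[OF X U] by blast
  show "clinear_on (G0 X) (rho X UNIV)"
    by (auto simp: clinear_on_def rho_def restr_def scaleC_fun_def scaleC_complex_def)
  \<comment> \<open>By the extension theorem, restriction maps the unit ball of \<open>HL0 UNIV\<close> onto that of \<open>HL0 X\<close>,
    so the two dual norms are suprema of the same set of numbers.\<close>
  obtain \<FF> where FF: "almost_linear_filter X \<FF>"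
    using almost_linear_filter_exists[OF X assms(4)] by blast
  have image: "restr (unit_ball X) ` HL0_ball UNIV = HL0_ball X"
  proof
    show "restr (unit_ball X) ` HL0_ball UNIV \<subseteq> HL0_ball X"
      using restr_HL0_ball[OF X U] by blast
    show "HL0_ball X \<subseteq> restr (unit_ball X) ` HL0_ball UNIV"
      using holomorphic_lipschitz_extension[OF X FF] by (metis image_eqI subsetI)
  qed
  fix \<phi> assume "\<phi> \<in> G0 X"
  have "(\<lambda>f. cmod (rho X UNIV \<phi> f)) ` HL0_ball UNIV = (\<lambda>f. cmod (\<phi> (restr (unit_ball X) f))) ` HL0_ball UNIV"
    by (rule image_cong) (auto simp: rho_def restr_def[of "HL0 UNIV"] HL0_ball_def)
  also have "\<dots> = (\<lambda>g. cmod (\<phi> g)) ` HL0_ball X" by (simp flip: image add: image_image)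
  finally show "G0_norm UNIV (rho X UNIV \<phi>) = G0_norm X \<phi>"
    by (simp add: G0_norm_def dual_norm_def HL0_ball_def)
qed

end
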